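(* Let $d\ge 2$ and let $H\leq\mathcal{N}_d$ be a finitely generated subgroup. If each element of $H$ induces an automorphism of some cofinite subforest of $\mathcal{T}_d$ (possibly depending on the element), then $H$ entirely lies in the automorphism group of a cofinite subforest of $\mathcal{T}_d$.
   Context: $\mathcal{T}_d$ denotes the rooted tree whose root has degree $1$ and all of whose other vertices have degree $d+1$ (i.e. the root has one child, every other vertex has $d$ children). For a rooted forest $\mathcal{F}$, $\lambda(\mathcal{F})$ is its set of roots. A rooted subforest $F\subset\mathcal{F}$ is admissible if it is finite (possibly empty) and its roots are among the roots of $\mathcal{F}$. The cofinite subforest $F^C=\mathcal{F}\setminus F$ is obtained from $\mathcal{F}$ by deleting the vertices of $F$ and all edges having at least one endpoint in $F$; it is a rooted forest whose set of roots $\lambda(F^C)$ consists of the roots of $\mathcal{F}$ not in $F$ and the children of vertices of $F$ that are not in $F$. "Cofinite subforest" means one of the form $F^C$ with $F$ admissible. An almost automorphism of $\mathcal{F}$ is an equivalence class of triples $(\psi,F,F')$ with $F,F'$ admissible and $\psi\colon F^C\to F'^C$ a rooted forest isomorphism (a forest isomorphism sending $\lambda(F^C)$ bijectively onto $\lambda(F'^C)$); $(\psi_1,F_1,F_1')\sim(\psi_2,F_2,F_2')$ if there are admissible $F\supset F_1,F_2$ and $F'\supset F_1',F_2'$ such that $\psi_1,\psi_2$ induce the same rooted forest isomorphism $F^C\to F'^C$. These form a group $\mathrm{AAut}(\mathcal{F})$ under composition (after enlarging representatives). $\mathcal{N}_d:=\mathrm{AAut}(\mathcal{T}_d)$ is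 the Neretin group. An element of $\mathcal{N}_d$ induces an automorphism of $F^C$ if it has a representative of the form $(\psi,F,F)$; the automorphism group of $F^C$, as a subgroup of $\mathcal{N}_d$, consists of all such elements. *)

theory Defs
  imports "HOL-Algebra.Generated_Groups"
begin

section \<open>Rooted forests\<close>

text \<open>
  The edges of a rooted forest are oriented away from the roots: an arc \<open>(u, v)\<close> means that
  \<open>v\<close> is a child of \<open>u\<close>. The roots are then the vertices without a parent.
\<close>

record 'a forest =
  verts :: "'a set"
  arcs :: "('a \<times> 'a) set"

definition roots :: "'a forest \<Rightarrow> 'a set" where
  "roots T = {v \<in> verts T. \<forall>u. (u, v) \<notin> arcs T}"

definition rooted_forest :: "'a forest \<Rightarrow> bool" where
  "rooted_forest T \<longleftrightarrow>
     arcs T \<subseteq> verts T \<times> verts T \<and>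
     (\<forall>u u' v. (u, v) \<in> arcs T \<longrightarrow> (u', v) \<in> arcs T \<longrightarrow> u = u') \<and>
     (\<forall>v \<in> verts T. \<exists>r \<in> roots T. (r, v) \<in> (arcs T)\<^sup>*)"

definition adjacent :: "'a forest \<Rightarrow> 'a \<Rightarrow> 'a \<Rightarrow> bool" where
  "adjacent T x y \<longleftrightarrow> (x, y) \<in> arcs T \<or> (y, x) \<in> arcs T"

definition rooted_forest_iso :: "('a \<Rightarrow> 'b) \<Rightarrow> 'a forest \<Rightarrow> 'b forest \<Rightarrow> bool" where
  "rooted_forest_iso \<psi> S T \<longleftrightarrow>
     bij_betw \<psi> (verts S) (verts T) \<and>
     (\<forall>x \<in> verts S. \<forall>y \<in> verts S. adjacent S x y \<longleftrightarrow> adjacent T (\<psi> x) (\<psi> y)) \<and>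
     bij_betw \<psi> (roots S) (roots T)"

definition induced_subforest :: "'a forest \<Rightarrow> 'a set \<Rightarrow> 'a forest" where
  "induced_subforest T V = \<lparr>verts = V, arcs = arcs T \<inter> V \<times> V\<rparr>"

text \<open>
  Admissible subforests are represented by their vertex sets. Nothing is lost: if an edge between
  two vertices of a subforest were missing in it, its lower endpoint would be a root of the
  subforest without being a root of \<open>T\<close>.
\<close>

definition admissible :: "'a forest \<Rightarrow> 'a set \<Rightarrow> bool" where
  "admissible T F \<longleftrightarrow>
     F \<subseteq> verts T \<and> finite F \<and> roots (induced_subforest T F) \<subseteq> roots T"

definition cofinite_subforest :: "'a forest \<Rightarrow> 'a set \<Rightarrow> 'a forest" where
  "cofinite_subforest T F = induced_subforest T (verts T - F)"


section \<open>Almost automorphisms\<close>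

text \<open>
  In a triple \<open>(\<psi>, F, F')\<close> the map \<open>\<psi>\<close> is a total function, but only its values on the vertices
  of the complement of \<open>F\<close> matter; the equivalence relation below ignores all other values.
\<close>

definition aaut_triples :: "'a forest \<Rightarrow> (('a \<Rightarrow> 'a) \<times> 'a set \<times> 'a set) set" where
  "aaut_triples T = {(\<psi>, F, F'). admissible T F \<and> admissible T F' \<and>
     rooted_forest_iso \<psi> (cofinite_subforest T F) (cofinite_subforest T F')}"

definition aaut_rel ::
  "'a forest \<Rightarrow> ((('a \<Rightarrow> 'a) \<times> 'a set \<times> 'a set) \<times> (('a \<Rightarrow> 'a) \<times> 'a set \<times> 'a set)) set" where
  "aaut_rel T = {((\<psi>1, F1, F1'), (\<psi>2, F2, F2')).
     (\<psi>1, F1, F1') \<in> aaut_triples T \<and> (\<psi>2, F2, F2') \<in> aaut_triples T \<and>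
     (\<exists>F F'. admissible T F \<and> admissible T F' \<and>
        F1 \<subseteq> F \<and> F2 \<subseteq> F \<and> F1' \<subseteq> F' \<and> F2' \<subseteq> F' \<and>
        rooted_forest_iso \<psi>1 (cofinite_subforest T F) (cofinite_subforest T F') \<and>
        rooted_forest_iso \<psi>2 (cofinite_subforest T F) (cofinite_subforest T F') \<and>
        (\<forall>x \<in> verts (cofinite_subforest T F). \<psi>1 x = \<psi>2 x))}"

text \<open>
  The product of two classes is formed from representatives \<open>(\<psi>, G, G')\<close> and \<open>(\<phi>, E, G)\<close> whose
  middle subforests agree. Such representatives exist and all of them give the same class, so the
  union below is a single class; see \<open>aaut_class_mult\<close> and \<open>aaut_match\<close>.
\<close>

definition AAut :: "'a forest \<Rightarrow> (('a \<Rightarrow> 'a) \<times> 'a set \<times> 'a set) set monoid" where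
  "AAut T = \<lparr>carrier = aaut_triples T // aaut_rel T,
     mult = (\<lambda>A B. \<Union> {aaut_rel T `` {(\<psi> \<circ> \<phi>, E, G')} | \<psi> \<phi> E G G'.
                        (\<psi>, G, G') \<in> A \<and> (\<phi>, E, G) \<in> B}),
     one = aaut_rel T `` {(id, {}, {})}\<rparr>"

definition aut_cofinite :: "'a forest \<Rightarrow> 'a set \<Rightarrow> (('a \<Rightarrow> 'a) \<times> 'a set \<times> 'a set) set set" where
  "aut_cofinite T F = {g \<in> carrier (AAut T). \<exists>\<psi>. (\<psi>, F, F) \<in> g}"


section \<open>The Neretin group\<close>

text \<open>
  Vertices are addressed by lists: the root is the empty list and the children of \<open>v\<close> are lists
  \<open>v @ [i]\<close>. The root has the single child \<open>[0]\<close>, every other vertex has \<open>d\<close> children.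
\<close>

definition tree_T :: "nat \<Rightarrow> nat list forest" where
  "tree_T d = (let V = insert [] {0 # w | w. set w \<subseteq> {..<d}} in
     \<lparr>verts = V, arcs = {(v, v @ [i]) | v i. v \<in> V \<and> v @ [i] \<in> V}\<rparr>)"

definition neretin :: "nat \<Rightarrow> ((nat list \<Rightarrow> nat list) \<times> nat list set \<times> nat list set) set monoid" where
  "neretin d = AAut (tree_T d)"

definition finitely_generated_subgroup :: "('a, 'b) monoid_scheme \<Rightarrow> 'a set \<Rightarrow> bool" where
  "finitely_generated_subgroup G H \<longleftrightarrow>
     subgroup H G \<and> (\<exists>S. finite S \<and> S \<subseteq> carrier G \<and> H = generate G S)"

lemma tree_T_children_root: "{v. ([], v) \<in> arcs (tree_T d)} = {[0]}"
  by (auto simp: tree_T_def Let_def)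

lemma tree_T_children:
  assumes "v \<in> verts (tree_T d)" "v \<noteq> []"
  shows "card {w. (v, w) \<in> arcs (tree_T d)} = d"
proof -
  have "{w. (v, w) \<in> arcs (tree_T d)} = (\<lambda>i. v @ [i]) ` {..<d}"
    using assms by (auto simp: tree_T_def Let_def)
  then show ?thesis
    by (simp add: card_image inj_on_def)
qed

lemma roots_tree_T: "roots (tree_T d) = {[]}"
proof -
  have "\<exists>u. (u, v) \<in> arcs (tree_T d)" if "v \<in> verts (tree_T d)" "v \<noteq> []" for v
  proof -
    from that obtain w where w: "v = 0 # w" "set w \<subseteq> {..<d}"
      by (auto simp: tree_T_def Let_def)
    show ?thesis
    proof (cases w rule: rev_cases)
      case Nil
      then show ?thesis using w by (auto simp: tree_T_def Let_def)
    next
      case (snoc u i)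
      then have "(0 # u, v) \<in> arcs (tree_T d)" using w by (auto simp: tree_T_def Let_def)
      then show ?thesis ..
    qed
  qed
  moreover have "[] \<in> verts (tree_T d)" "(u, []) \<notin> arcs (tree_T d)" for u
    by (simp_all add: tree_T_def Let_def)
  ultimately show ?thesis
    unfolding roots_def by blast
qed

lemma rooted_forest_tree_T: "rooted_forest (tree_T d)"
proof -
  have arc: "u \<in> verts (tree_T d) \<and> v \<in> verts (tree_T d) \<and> v \<noteq> [] \<and> u = butlast v"
    if "(u, v) \<in> arcs (tree_T d)" for u v
    using that by (auto simp: tree_T_def Let_def)
  have "([], v) \<in> (arcs (tree_T d))\<^sup>*" if "v \<in> verts (tree_T d)" for v
    using that
  proof (induction "length v" arbitrary: v rule: less_induct)
    case less
    show ?case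
    proof (cases "v = []")
      case False
      then have "v \<notin> roots (tree_T d)" by (simp add: roots_tree_T)
      with less.prems obtain u where u: "(u, v) \<in> arcs (tree_T d)"
        by (auto simp: roots_def)
      have "length u < length v" "u \<in> verts (tree_T d)"
        using arc[OF u] by auto
      then have "([], u) \<in> (arcs (tree_T d))\<^sup>*" by (rule less.hyps)
      then show ?thesis using u by (rule rtrancl_into_rtrancl)
    qed simp
  qed
  then have "\<forall>v \<in> verts (tree_T d). \<exists>r \<in> roots (tree_T d). (r, v) \<in> (arcs (tree_T d))\<^sup>*"
    by (simp add: roots_tree_T)
  moreover have "arcs (tree_T d) \<subseteq> verts (tree_T d) \<times> verts (tree_T d)"
    using arc by auto
  moreover have "\<forall>u u' v. (u, v) \<in> arcs (tree_T d) \<longrightarrow> (u', v) \<in> arcs (tree_T d) \<longrightarrow> u = u'"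
    using arc by metis
  ultimately show ?thesis
    unfolding rooted_forest_def by (intro conjI)
qed


section \<open>The almost automorphisms form a group\<close>

lemma cofinite_simps [simp]:
  "verts (cofinite_subforest T F) = verts T - F"
  "arcs (cofinite_subforest T F) = arcs T \<inter> (verts T - F) \<times> (verts T - F)"
  by (simp_all add: cofinite_subforest_def induced_subforest_def)

lemma admissible_iff:
  assumes "rooted_forest T"
  shows "admissible T F \<longleftrightarrow>
    F \<subseteq> verts T \<and> finite F \<and> (\<forall>u v. (u, v) \<in> arcs T \<longrightarrow> v \<in> F \<longrightarrow> u \<in> F)"
proof
  assume A: "admissible T F"
  have "u \<in> F" if "(u, v) \<in> arcs T" "v \<in> F" for u v
  proof (rule ccontr)
    assume "u \<notin> F"
    with that assms have "v \<in> roots (induced_subforest T F)"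
      unfolding roots_def induced_subforest_def rooted_forest_def by auto
    with A that show False by (auto simp: admissible_def roots_def)
  qed
  with A show "F \<subseteq> verts T \<and> finite F \<and> (\<forall>u v. (u, v) \<in> arcs T \<longrightarrow> v \<in> F \<longrightarrow> u \<in> F)"
    by (simp add: admissible_def)
next
  assume "F \<subseteq> verts T \<and> finite F \<and> (\<forall>u v. (u, v) \<in> arcs T \<longrightarrow> v \<in> F \<longrightarrow> u \<in> F)"
  then show "admissible T F"
    unfolding admissible_def roots_def induced_subforest_def by simp blast
qed

lemma rooted_forest_cofinite:
  assumes T: "rooted_forest T"
  shows "rooted_forest (cofinite_subforest T F)"
proof -
  let ?C = "cofinite_subforest T F"
  have "v \<in> verts T - F \<longrightarrow> (\<exists>q \<in> roots ?C. (q, v) \<in> (arcs ?C)\<^sup>*)"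
    if "(r, v) \<in> (arcs T)\<^sup>*" "r \<in> roots T" for r v
    using that(1)
  proof (induction rule: rtrancl_induct)
    case base
    from that(2) show ?case by (auto simp: roots_def)
  next
    case (step u v)
    show ?case
    proof
      assume v: "v \<in> verts T - F"
      show "\<exists>q \<in> roots ?C. (q, v) \<in> (arcs ?C)\<^sup>*"
      proof (cases "u \<in> F")
        case True
        with v step T have "v \<in> roots ?C" by (auto simp: roots_def rooted_forest_def)
        then show ?thesis by blast
      next
        case False
        with step T v have "u \<in> verts T - F" "(u, v) \<in> arcs ?C" by (auto simp: rooted_forest_def)
        with step show ?thesis by (meson rtrancl.rtrancl_into_rtrancl)
      qed
    qed
  qed
  with T show ?thesis by (simp add: rooted_forest_def) blast
qed

lemma roots_cofinite_subforest:
  assumes T: "rooted_forest T"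
  shows "roots (cofinite_subforest T F) =
    (roots T - F) \<union> {v \<in> verts T - F. \<exists>u \<in> F. (u, v) \<in> arcs T}"
proof -
  have "v \<in> roots (cofinite_subforest T F) \<longleftrightarrow>
      v \<in> roots T \<or> (\<exists>u \<in> F. (u, v) \<in> arcs T)" if v: "v \<in> verts T - F" for v
  proof (cases "\<exists>u. (u, v) \<in> arcs T")
    case True
    then obtain u where u: "(u, v) \<in> arcs T" ..
    with T have "u \<in> verts T" "\<And>w. (w, v) \<in> arcs T \<longleftrightarrow> w = u"
      by (auto simp: rooted_forest_def)
    with v show ?thesis by (auto simp: roots_def)
  qed (use v in \<open>auto simp: roots_def\<close>)
  then show ?thesis by (auto simp: roots_def)
qed

lemma rooted_forest_no_2cycle:
  assumes T: "rooted_forest T" and "(u, v) \<in> arcs T" "(v, u) \<in> arcs T"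
  shows False
proof -
  have *: "\<nexists>u. (u, v) \<in> arcs T \<and> (v, u) \<in> arcs T" if "(r, v) \<in> (arcs T)\<^sup>*" "r \<in> roots T" for r v
    using that(1)
  proof (induction rule: rtrancl_induct)
    case base
    from that(2) show ?case by (auto simp: roots_def)
  next
    case (step x y)
    with T show ?case unfolding rooted_forest_def by metis
  qed
  from assms have "v \<in> verts T" by (auto simp: rooted_forest_def)
  with T obtain r where "r \<in> roots T" "(r, v) \<in> (arcs T)\<^sup>*" unfolding rooted_forest_def by blast
  with * assms show False by blast
qed

lemma rooted_forest_iso_arcs:
  assumes S: "rooted_forest S" and T: "rooted_forest T" and iso: "rooted_forest_iso \<psi> S T"
    and uv: "(u, v) \<in> arcs S"
  shows "(\<psi> u, \<psi> v) \<in> arcs T"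
proof -
  note S' = S[unfolded rooted_forest_def] and T' = T[unfolded rooted_forest_def]
  note iso' = iso[unfolded rooted_forest_iso_def]
  have *: "\<forall>u. (u, v) \<in> arcs S \<longrightarrow> (\<psi> u, \<psi> v) \<in> arcs T"
    if "(r, v) \<in> (arcs S)\<^sup>*" "r \<in> roots S" for r v
    using that(1)
  proof (induction rule: rtrancl_induct)
    case base
    from that(2) show ?case by (auto simp: roots_def)
  next
    case (step x y)
    have xy: "x \<in> verts S" "y \<in> verts S" using step S' by auto
    have "(\<psi> x, \<psi> y) \<in> arcs T"
    proof (rule ccontr)
      assume "(\<psi> x, \<psi> y) \<notin> arcs T"
      with xy step iso' have yx: "(\<psi> y, \<psi> x) \<in> arcs T" by (auto simp: adjacent_def)
      then have "\<psi> x \<notin> roots T" by (auto simp: roots_def)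
      with iso' have "x \<notin> roots S" by (auto simp: bij_betw_def)
      with xy obtain w where w: "(w, x) \<in> arcs S" by (auto simp: roots_def)
      with step have "(\<psi> w, \<psi> x) \<in> arcs T" by blast
      with yx T' have "\<psi> w = \<psi> y" by blast
      with w S' iso' xy have "w = y" by (auto simp: bij_betw_def dest: inj_onD)
      with w step S rooted_forest_no_2cycle show False by metis
    qed
    moreover have "u = x" if "(u, y) \<in> arcs S" for u using that step S' by blast
    ultimately show ?case by blast
  qed
  from uv S' have "v \<in> verts S" by auto
  with S' obtain r where "r \<in> roots S" "(r, v) \<in> (arcs S)\<^sup>*" by blast
  with * uv show ?thesis by blast
qed

lemma rooted_forest_iso_inv:
  assumes iso: "rooted_forest_iso \<psi> S T"
  shows "rooted_forest_iso (inv_into (verts S) \<psi>) T S"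
proof -
  let ?i = "inv_into (verts S) \<psi>"
  have b: "bij_betw \<psi> (verts S) (verts T)" and r: "bij_betw \<psi> (roots S) (roots T)"
    and a: "\<forall>x \<in> verts S. \<forall>y \<in> verts S. adjacent S x y \<longleftrightarrow> adjacent T (\<psi> x) (\<psi> y)"
    using iso by (auto simp: rooted_forest_iso_def)
  have i: "?i y \<in> verts S" "\<psi> (?i y) = y" if "y \<in> verts T" for y
    using b that by (auto simp: bij_betw_def f_inv_into_f inv_into_into)
  have "bij_betw ?i (roots T) (roots S)"
    by (rule bij_betw_inv_into_subset[OF b]) (use r in \<open>auto simp: bij_betw_def roots_def\<close>)
  moreover have "adjacent T x y \<longleftrightarrow> adjacent S (?i x) (?i y)"
    if "x \<in> verts T" "y \<in> verts T" for x y
    using a[rule_format, of "?i x" "?i y"] i[OF that(1)] i[OF that(2)] by simp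
  ultimately show ?thesis
    using bij_betw_inv_into[OF b] by (simp add: rooted_forest_iso_def)
qed

lemma rooted_forest_iso_iff:
  assumes S: "rooted_forest S" and T: "rooted_forest T"
  shows "rooted_forest_iso \<psi> S T \<longleftrightarrow>
     bij_betw \<psi> (verts S) (verts T) \<and>
     (\<forall>x \<in> verts S. \<forall>y \<in> verts S. (x, y) \<in> arcs S \<longleftrightarrow> (\<psi> x, \<psi> y) \<in> arcs T)" (is "?L \<longleftrightarrow> ?R")
proof
  assume L: ?L
  then have b: "bij_betw \<psi> (verts S) (verts T)" by (simp add: rooted_forest_iso_def)
  have "(x, y) \<in> arcs S" if "x \<in> verts S" "y \<in> verts S" "(\<psi> x, \<psi> y) \<in> arcs T" for x y
    using rooted_forest_iso_arcs[OF T S rooted_forest_iso_inv[OF L] that(3)] b that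
    by (simp add: bij_betw_def)
  with b rooted_forest_iso_arcs[OF S T L] show ?R by blast
next
  assume R: ?R
  then have b: "bij_betw \<psi> (verts S) (verts T)" by blast
  have m: "\<psi> x \<in> roots T \<longleftrightarrow> x \<in> roots S" if x: "x \<in> verts S" for x
  proof -
    have "(\<exists>u. (u, x) \<in> arcs S) \<longleftrightarrow> (\<exists>w. (w, \<psi> x) \<in> arcs T)"
    proof
      assume "\<exists>u. (u, x) \<in> arcs S"
      then obtain u where u: "(u, x) \<in> arcs S" ..
      with S have "u \<in> verts S" by (auto simp: rooted_forest_def)
      with R u x have "(\<psi> u, \<psi> x) \<in> arcs T" by simp
      then show "\<exists>w. (w, \<psi> x) \<in> arcs T" ..
    next
      assume "\<exists>w. (w, \<psi> x) \<in> arcs T"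
      then obtain w where w: "(w, \<psi> x) \<in> arcs T" ..
      with T have "w \<in> verts T" by (auto simp: rooted_forest_def)
      with b obtain u where u: "u \<in> verts S" "w = \<psi> u" by (auto simp: bij_betw_def)
      with R w x have "(u, x) \<in> arcs S" by simp
      then show "\<exists>u. (u, x) \<in> arcs S" ..
    qed
    with b x show ?thesis by (auto simp: roots_def bij_betw_def)
  qed
  have "\<psi> ` roots S = roots T"
  proof
    show "\<psi> ` roots S \<subseteq> roots T" using m by (auto simp: roots_def)
    show "roots T \<subseteq> \<psi> ` roots S"
    proof
      fix y assume y: "y \<in> roots T"
      then have "y \<in> verts T" by (auto simp: roots_def)
      with b obtain x where "x \<in> verts S" "y = \<psi> x" by (auto simp: bij_betw_def)
      with m y show "y \<in> \<psi> ` roots S" by blast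
    qed
  qed
  moreover have "inj_on \<psi> (roots S)"
    using b by (auto simp: bij_betw_def roots_def intro: inj_on_subset)
  ultimately show ?L
    using R by (auto simp: rooted_forest_iso_def adjacent_def bij_betw_def)
qed

lemma aaut_triples_iff:
  assumes T: "rooted_forest T"
  shows "(\<psi>, F, F') \<in> aaut_triples T \<longleftrightarrow> admissible T F \<and> admissible T F' \<and>
     bij_betw \<psi> (verts T - F) (verts T - F') \<and>
     (\<forall>x \<in> verts T - F. \<forall>y \<in> verts T - F. (x, y) \<in> arcs T \<longleftrightarrow> (\<psi> x, \<psi> y) \<in> arcs T)"
proof -
  have "rooted_forest_iso \<psi> (cofinite_subforest T F) (cofinite_subforest T F') \<longleftrightarrow>
     bij_betw \<psi> (verts T - F) (verts T - F') \<and>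
     (\<forall>x \<in> verts T - F. \<forall>y \<in> verts T - F. (x, y) \<in> arcs T \<longleftrightarrow> (\<psi> x, \<psi> y) \<in> arcs T)"
    unfolding rooted_forest_iso_iff[OF rooted_forest_cofinite[OF T] rooted_forest_cofinite[OF T]]
    by (intro conj_cong) (auto dest: bij_betwE)
  then show ?thesis by (simp add: aaut_triples_def)
qed

lemma admissible_Un:
  assumes "rooted_forest T" "admissible T F" "admissible T G"
  shows "admissible T (F \<union> G)"
  using assms by (auto simp: admissible_iff)

lemma aaut_triples_enlarge:
  assumes T: "rooted_forest T" and t: "(\<psi>, E, E') \<in> aaut_triples T"
    and F: "admissible T F" "E \<subseteq> F"
  obtains F' where "(\<psi>, F, F') \<in> aaut_triples T" "E' \<subseteq> F'" "verts T - F' = \<psi> ` (verts T - F)"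
proof
  let ?F' = "verts T - \<psi> ` (verts T - F)"
  note t' = t[unfolded aaut_triples_iff[OF T]] and ad = admissible_iff[OF T]
  have b: "bij_betw \<psi> (verts T - E) (verts T - E')" using t' by blast
  then have im: "\<psi> ` (verts T - E) = verts T - E'" and inj: "inj_on \<psi> (verts T - E)"
    by (auto simp: bij_betw_def)
  have sub: "verts T - F \<subseteq> verts T - E" using F by blast
  have subset: "?F' \<subseteq> E' \<union> \<psi> ` (F - E)"
  proof
    fix y assume y: "y \<in> ?F'"
    show "y \<in> E' \<union> \<psi> ` (F - E)"
    proof (cases "y \<in> E'")
      case False
      with y im obtain x where "x \<in> verts T - E" "y = \<psi> x" by blast
      with y show ?thesis by blast
    qed simp
  qed
  have EF: "E' \<subseteq> ?F'" using im sub t' ad by auto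
  have "finite ?F'"
    by (rule finite_subset[OF subset]) (use t' F ad in auto)
  moreover have "u \<in> ?F'" if uv: "(u, v) \<in> arcs T" and v: "v \<in> ?F'" for u v
  proof (rule ccontr)
    assume "u \<notin> ?F'"
    moreover have uvV: "u \<in> verts T" "v \<in> verts T" using uv T by (auto simp: rooted_forest_def)
    ultimately obtain x where x: "x \<in> verts T - F" "u = \<psi> x" by blast
    show False
    proof (cases "v \<in> E'")
      case True
      with uv t' ad have "u \<in> E'" by blast
      with EF \<open>u \<notin> ?F'\<close> show False by blast
    next
      case False
      with uvV im obtain y where y: "y \<in> verts T - E" "v = \<psi> y" by blast
      with x sub uv t' have "(x, y) \<in> arcs T" by blast
      moreover have "y \<in> F" using v y by blast
      ultimately show False using F x ad by blast
    qed
  qed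
  ultimately have adF': "admissible T ?F'" by (auto simp: ad)
  show eq: "verts T - ?F' = \<psi> ` (verts T - F)" using im sub by auto
  have "bij_betw \<psi> (verts T - F) (verts T - ?F')"
    unfolding eq using inj_on_subset[OF inj sub] by (rule inj_on_imp_bij_betw)
  then show "(\<psi>, F, ?F') \<in> aaut_triples T"
    using adF' F t' sub by (auto simp: aaut_triples_iff[OF T])
  show "E' \<subseteq> ?F'" by (fact EF)
qed

lemma aaut_triples_inv:
  assumes "(\<psi>, E, E') \<in> aaut_triples T"
  shows "(inv_into (verts T - E) \<psi>, E', E) \<in> aaut_triples T"
proof -
  have "admissible T E" "admissible T E'"
    "rooted_forest_iso \<psi> (cofinite_subforest T E) (cofinite_subforest T E')"
    using assms by (auto simp: aaut_triples_def)
  then show ?thesis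
    using rooted_forest_iso_inv by (fastforce simp: aaut_triples_def)
qed

lemma aaut_triples_enlarge_target:
  assumes T: "rooted_forest T" and t: "(\<psi>, E, E') \<in> aaut_triples T"
    and F': "admissible T F'" "E' \<subseteq> F'"
  obtains F where "(\<psi>, F, F') \<in> aaut_triples T" "E \<subseteq> F"
proof -
  let ?i = "inv_into (verts T - E) \<psi>"
  obtain F where F: "(?i, F', F) \<in> aaut_triples T" "E \<subseteq> F" "verts T - F = ?i ` (verts T - F')"
    using aaut_triples_enlarge[OF T aaut_triples_inv[OF t] F'] by metis
  have aF: "admissible T F" using F by (simp add: aaut_triples_def)
  obtain F'' where F'': "(\<psi>, F, F'') \<in> aaut_triples T" "verts T - F'' = \<psi> ` (verts T - F)"
    using aaut_triples_enlarge[OF T t aF F(2)] by metis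
  have "\<psi> ` (verts T - E) = verts T - E'"
    using t by (auto simp: aaut_triples_iff[OF T] bij_betw_def)
  then have "\<psi> (?i y) = y" if "y \<in> verts T - F'" for y
    using that F' by (intro f_inv_into_f) auto
  then have "verts T - F'' = verts T - F'" using F F'' by (auto simp: image_iff)
  moreover have "F' \<subseteq> verts T" "F'' \<subseteq> verts T"
    using F' F'' by (auto simp: aaut_triples_def admissible_def)
  ultimately have "F'' = F'" by blast
  with F'' F that show ?thesis by blast
qed

lemma aaut_triples_comp:
  assumes T: "rooted_forest T"
    and "(\<psi>, G, G') \<in> aaut_triples T" "(\<phi>, E, G) \<in> aaut_triples T"
  shows "(\<psi> \<circ> \<phi>, E, G') \<in> aaut_triples T"
proof -
  have "bij_betw (\<psi> \<circ> \<phi>) (verts T - E) (verts T - G')"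
    using assms by (auto simp: aaut_triples_iff[OF T] intro: bij_betw_trans)
  moreover have "\<phi> ` (verts T - E) = verts T - G"
    using assms by (auto simp: aaut_triples_iff[OF T] bij_betw_def)
  then have "\<phi> x \<in> verts T - G" if "x \<in> verts T - E" for x using that by blast
  ultimately show ?thesis
    using assms by (auto simp: aaut_triples_iff[OF T])
qed

lemma aaut_rel_iff:
  assumes T: "rooted_forest T"
  shows "((\<psi>1, F1, F1'), (\<psi>2, F2, F2')) \<in> aaut_rel T \<longleftrightarrow>
     (\<psi>1, F1, F1') \<in> aaut_triples T \<and> (\<psi>2, F2, F2') \<in> aaut_triples T \<and>
     (\<exists>F. admissible T F \<and> F1 \<subseteq> F \<and> F2 \<subseteq> F \<and> (\<forall>x \<in> verts T - F. \<psi>1 x = \<psi>2 x))" (is "?L \<longleftrightarrow> ?R")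
proof
  assume R: ?R
  then obtain F where F: "admissible T F" "F1 \<subseteq> F" "F2 \<subseteq> F" "\<forall>x \<in> verts T - F. \<psi>1 x = \<psi>2 x"
    by blast
  from R have t: "(\<psi>1, F1, F1') \<in> aaut_triples T" "(\<psi>2, F2, F2') \<in> aaut_triples T" by auto
  obtain F' where F': "(\<psi>1, F, F') \<in> aaut_triples T" "F1' \<subseteq> F'" "verts T - F' = \<psi>1 ` (verts T - F)"
    using aaut_triples_enlarge[OF T t(1) F(1,2)] by metis
  obtain F'' where F'': "(\<psi>2, F, F'') \<in> aaut_triples T" "F2' \<subseteq> F''" "verts T - F'' = \<psi>2 ` (verts T - F)"
    using aaut_triples_enlarge[OF T t(2) F(1,3)] by metis
  have "verts T - F' = verts T - F''" using F' F'' F(4) by (auto simp: image_iff)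
  moreover have "F' \<subseteq> verts T" "F'' \<subseteq> verts T"
    using F' F'' by (auto simp: aaut_triples_def admissible_def)
  ultimately have "F'' = F'" by blast
  then show ?L
    using t F F' F'' unfolding aaut_rel_def aaut_triples_def by auto
qed (auto simp: aaut_rel_def)

lemma equiv_aaut_rel:
  assumes T: "rooted_forest T"
  shows "equiv (aaut_triples T) (aaut_rel T)"
proof (rule equivI)
  show "aaut_rel T \<subseteq> aaut_triples T \<times> aaut_triples T" by (auto simp: aaut_rel_def)
  show "refl_on (aaut_triples T) (aaut_rel T)"
    by (rule refl_onI) (auto simp: aaut_rel_iff[OF T] aaut_triples_def)
  show "sym (aaut_rel T)"
    by (rule symI) (auto simp: aaut_rel_iff[OF T] split_paired_all)
  show "trans (aaut_rel T)"
  proof (rule transI)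
    fix a b c assume "(a, b) \<in> aaut_rel T" "(b, c) \<in> aaut_rel T"
    moreover obtain \<psi>1 F1 F1' \<psi>2 F2 F2' \<psi>3 F3 F3'
      where abc: "a = (\<psi>1, F1, F1')" "b = (\<psi>2, F2, F2')" "c = (\<psi>3, F3, F3')"
      by (metis prod_cases3)
    ultimately obtain F G
      where "admissible T F" "F1 \<subseteq> F" "F2 \<subseteq> F" "\<forall>x \<in> verts T - F. \<psi>1 x = \<psi>2 x"
        "admissible T G" "F2 \<subseteq> G" "F3 \<subseteq> G" "\<forall>x \<in> verts T - G. \<psi>2 x = \<psi>3 x"
        "a \<in> aaut_triples T" "c \<in> aaut_triples T"
      by (auto simp: aaut_rel_iff[OF T])
    moreover from this have "admissible T (F \<union> G)" using admissible_Un[OF T] by blast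
    moreover have "F1 \<subseteq> F \<union> G \<and> F3 \<subseteq> F \<union> G \<and> (\<forall>x \<in> verts T - (F \<union> G). \<psi>1 x = \<psi>3 x)"
      using calculation by auto
    ultimately show "(a, c) \<in> aaut_rel T"
      unfolding abc aaut_rel_iff[OF T] by blast
  qed
qed

abbreviation aaut_class where
  "aaut_class T \<psi> F F' \<equiv> aaut_rel T `` {(\<psi>, F, F')}"

lemma aaut_class_enlarge:
  assumes T: "rooted_forest T"
    and "(\<psi>, E, E') \<in> aaut_triples T" "(\<psi>, F, F') \<in> aaut_triples T"
  shows "aaut_class T \<psi> E E' = aaut_class T \<psi> F F'"
proof (rule equiv_class_eq[OF equiv_aaut_rel[OF T]])
  have "admissible T (E \<union> F)" using assms by (auto simp: aaut_triples_def intro: admissible_Un)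
  with assms show "((\<psi>, E, E'), (\<psi>, F, F')) \<in> aaut_rel T" by (auto simp: aaut_rel_iff)
qed

lemma aaut_carrierE:
  assumes "A \<in> carrier (AAut T)"
  obtains \<psi> F F' where "(\<psi>, F, F') \<in> aaut_triples T" "A = aaut_class T \<psi> F F'"
  using assms by (auto simp: AAut_def elim!: quotientE)

lemma aaut_carrierI: "(\<psi>, F, F') \<in> aaut_triples T \<Longrightarrow> aaut_class T \<psi> F F' \<in> carrier (AAut T)"
  by (simp add: AAut_def quotientI)

lemma aaut_rel_comp:
  assumes T: "rooted_forest T"
    and r: "((\<psi>, G, G'), (\<psi>2, G2, G2')) \<in> aaut_rel T" "((\<phi>, E, G), (\<phi>2, E2, G2)) \<in> aaut_rel T"
  shows "((\<psi> \<circ> \<phi>, E, G'), (\<psi>2 \<circ> \<phi>2, E2, G2')) \<in> aaut_rel T"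
proof -
  have t: "(\<psi>, G, G') \<in> aaut_triples T" "(\<psi>2, G2, G2') \<in> aaut_triples T"
    "(\<phi>, E, G) \<in> aaut_triples T" "(\<phi>2, E2, G2) \<in> aaut_triples T"
    using r by (auto simp: aaut_rel_def)
  obtain K where K: "admissible T K" "G \<subseteq> K" "G2 \<subseteq> K" "\<forall>x \<in> verts T - K. \<psi> x = \<psi>2 x"
    using r by (auto simp: aaut_rel_iff[OF T])
  obtain L where L: "admissible T L" "E \<subseteq> L" "E2 \<subseteq> L" "\<forall>x \<in> verts T - L. \<phi> x = \<phi>2 x"
    using r by (auto simp: aaut_rel_iff[OF T])
  obtain M where M: "(\<phi>, M, K) \<in> aaut_triples T" "E \<subseteq> M"
    using aaut_triples_enlarge_target[OF T t(3) K(1,2)] by metis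
  then have "\<phi> ` (verts T - M) = verts T - K"
    by (auto simp: aaut_triples_iff[OF T] bij_betw_def)
  then have "\<phi> x \<in> verts T - K" if "x \<in> verts T - M" for x using that by blast
  then have "(\<psi> \<circ> \<phi>) x = (\<psi>2 \<circ> \<phi>2) x" if "x \<in> verts T - (L \<union> M)" for x
  proof -
    have "x \<in> verts T - M" "x \<in> verts T - L" using that by auto
    then have "\<phi> x \<in> verts T - K" "\<phi> x = \<phi>2 x"
      using \<open>\<And>x. x \<in> verts T - M \<Longrightarrow> \<phi> x \<in> verts T - K\<close> L(4) by (blast, blast)
    with K(4) show ?thesis by (metis comp_apply)
  qed
  moreover have "admissible T (L \<union> M)"
    using L M by (auto simp: aaut_triples_def intro: admissible_Un[OF T])
  moreover have "E \<subseteq> L \<union> M" "E2 \<subseteq> L \<union> M" using L(2,3) by auto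
  ultimately show ?thesis
    unfolding aaut_rel_iff[OF T]
    using aaut_triples_comp[OF T t(1,3)] aaut_triples_comp[OF T t(2,4)] by metis
qed

lemma aaut_class_mult:
  assumes T: "rooted_forest T"
    and t: "(\<psi>, G, G') \<in> aaut_triples T" "(\<phi>, E, G) \<in> aaut_triples T"
  shows "aaut_class T \<psi> G G' \<otimes>\<^bsub>AAut T\<^esub> aaut_class T \<phi> E G = aaut_class T (\<psi> \<circ> \<phi>) E G'"
proof -
  have self: "(\<psi>, G, G') \<in> aaut_class T \<psi> G G'" "(\<phi>, E, G) \<in> aaut_class T \<phi> E G"
    using equiv_class_self[OF equiv_aaut_rel[OF T]] t by auto
  have "aaut_class T (\<psi>2 \<circ> \<phi>2) E2 G2' = aaut_class T (\<psi> \<circ> \<phi>) E G'"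
    if "(\<psi>2, G2, G2') \<in> aaut_class T \<psi> G G'" "(\<phi>2, E2, G2) \<in> aaut_class T \<phi> E G"
    for \<psi>2 G2 G2' \<phi>2 E2
    using that aaut_rel_comp[OF T] equiv_class_eq[OF equiv_aaut_rel[OF T]]
    by (metis Image_singleton_iff)
  with self have "{aaut_class T (\<psi>2 \<circ> \<phi>2) E2 G2' | \<psi>2 \<phi>2 E2 G2 G2'.
      (\<psi>2, G2, G2') \<in> aaut_class T \<psi> G G' \<and> (\<phi>2, E2, G2) \<in> aaut_class T \<phi> E G}
    = {aaut_class T (\<psi> \<circ> \<phi>) E G'}" by blast
  then show ?thesis by (simp add: AAut_def)
qed

lemma aaut_match:
  assumes T: "rooted_forest T" and A: "A \<in> carrier (AAut T)" and B: "B \<in> carrier (AAut T)"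
    and K: "admissible T K"
  obtains \<psi> \<phi> E G G' where "K \<subseteq> E" "(\<psi>, G, G') \<in> aaut_triples T" "(\<phi>, E, G) \<in> aaut_triples T"
    "A = aaut_class T \<psi> G G'" "B = aaut_class T \<phi> E G"
proof -
  obtain \<psi> H H' where a: "(\<psi>, H, H') \<in> aaut_triples T" "A = aaut_class T \<psi> H H'"
    using A by (rule aaut_carrierE)
  obtain \<phi> L L' where b: "(\<phi>, L, L') \<in> aaut_triples T" "B = aaut_class T \<phi> L L'"
    using B by (rule aaut_carrierE)
  have "admissible T (L \<union> K)"
    using b K by (auto simp: aaut_triples_def intro: admissible_Un[OF T])
  then obtain G0 where G0: "(\<phi>, L \<union> K, G0) \<in> aaut_triples T"
    using aaut_triples_enlarge[OF T b(1)] by (metis Un_upper1)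
  let ?G = "H \<union> G0"
  have adG: "admissible T ?G"
    using a G0 by (auto simp: aaut_triples_def intro: admissible_Un[OF T])
  obtain G' where G': "(\<psi>, ?G, G') \<in> aaut_triples T"
    using aaut_triples_enlarge[OF T a(1) adG] by (metis Un_upper1)
  obtain E where E: "(\<phi>, E, ?G) \<in> aaut_triples T" "L \<union> K \<subseteq> E"
    using aaut_triples_enlarge_target[OF T G0 adG] by (metis Un_upper2)
  show ?thesis
  proof (rule that)
    show "K \<subseteq> E" using E by blast
    show "A = aaut_class T \<psi> ?G G'" using a(2) aaut_class_enlarge[OF T a(1) G'] by simp
    show "B = aaut_class T \<phi> E ?G" using b(2) aaut_class_enlarge[OF T b(1) E(1)] by simp
  qed (fact G' E(1))+
qed

theorem group_AAut:
  assumes T: "rooted_forest T"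
  shows "group (AAut T)"
proof (rule groupI)
  have ad0: "admissible T {}" by (auto simp: admissible_iff[OF T])
  have id: "(id, F, F) \<in> aaut_triples T" if "admissible T F" for F
    using that by (auto simp: aaut_triples_iff[OF T])
  have one: "\<one>\<^bsub>AAut T\<^esub> = aaut_class T id F F" if "admissible T F" for F
    using aaut_class_enlarge[OF T id[OF ad0] id[OF that]] by (simp add: AAut_def)
  show "\<one>\<^bsub>AAut T\<^esub> \<in> carrier (AAut T)"
    using one[OF ad0] aaut_carrierI[OF id[OF ad0]] by simp
  show "A \<otimes>\<^bsub>AAut T\<^esub> B \<in> carrier (AAut T)"
    if AB: "A \<in> carrier (AAut T)" "B \<in> carrier (AAut T)" for A B
    by (rule aaut_match[OF T AB ad0])
      (simp add: aaut_class_mult[OF T] aaut_carrierI aaut_triples_comp[OF T])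
  show "(A \<otimes>\<^bsub>AAut T\<^esub> B) \<otimes>\<^bsub>AAut T\<^esub> C = A \<otimes>\<^bsub>AAut T\<^esub> (B \<otimes>\<^bsub>AAut T\<^esub> C)"
    if ABC: "A \<in> carrier (AAut T)" "B \<in> carrier (AAut T)" "C \<in> carrier (AAut T)" for A B C
  proof -
    obtain \<chi> J J' where c: "(\<chi>, J, J') \<in> aaut_triples T" "C = aaut_class T \<chi> J J'"
      using ABC(3) by (rule aaut_carrierE)
    then have "admissible T J'" by (simp add: aaut_triples_def)
    then obtain \<psi> \<phi> E G G' where
      ab: "J' \<subseteq> E" "(\<psi>, G, G') \<in> aaut_triples T" "(\<phi>, E, G) \<in> aaut_triples T"
        "A = aaut_class T \<psi> G G'" "B = aaut_class T \<phi> E G"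
      by (rule aaut_match[OF T ABC(1,2)])
    then have "admissible T E" by (simp add: aaut_triples_def)
    then obtain K where K: "(\<chi>, K, E) \<in> aaut_triples T"
      using aaut_triples_enlarge_target[OF T c(1)] ab(1) by metis
    have C: "C = aaut_class T \<chi> K E" using aaut_class_enlarge[OF T c(1) K] c by simp
    show ?thesis
      unfolding ab C
      by (simp add: aaut_class_mult[OF T] aaut_triples_comp[OF T] ab(2,3) K comp_assoc
        aaut_class_mult[OF T ab(2) aaut_triples_comp[OF T ab(3) K]]
        aaut_class_mult[OF T aaut_triples_comp[OF T ab(2,3)] K])
  qed
  fix A assume "A \<in> carrier (AAut T)"
  then obtain \<psi> F F' where a: "(\<psi>, F, F') \<in> aaut_triples T" "A = aaut_class T \<psi> F F'"
    by (rule aaut_carrierE)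
  then have F: "admissible T F" "admissible T F'" by (auto simp: aaut_triples_def)
  show "\<one>\<^bsub>AAut T\<^esub> \<otimes>\<^bsub>AAut T\<^esub> A = A"
    unfolding one[OF F(2)] a by (simp add: aaut_class_mult[OF T id[OF F(2)] a(1)])
  let ?i = "inv_into (verts T - F) \<psi>"
  note inv = aaut_triples_inv[OF a(1)]
  have "inj_on \<psi> (verts T - F)" using a by (auto simp: aaut_triples_iff[OF T] bij_betw_def)
  then have "((?i \<circ> \<psi>, F, F), (id, F, F)) \<in> aaut_rel T"
    using aaut_triples_comp[OF T inv a(1)] id[OF F(1)] F
    by (auto simp: aaut_rel_iff[OF T] intro!: exI[of _ F])
  then have "aaut_class T (?i \<circ> \<psi>) F F = \<one>\<^bsub>AAut T\<^esub>"
    using equiv_class_eq[OF equiv_aaut_rel[OF T]] one[OF F(1)] by metis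
  then show "\<exists>B \<in> carrier (AAut T). B \<otimes>\<^bsub>AAut T\<^esub> A = \<one>\<^bsub>AAut T\<^esub>"
    using aaut_class_mult[OF T inv a(1)] aaut_carrierI[OF inv] a(2) by metis
qed

lemma group_neretin: "group (neretin d)"
  unfolding neretin_def by (rule group_AAut[OF rooted_forest_tree_T])

end

theory Submission
  imports Defs "HOL-Library.Sublist"
begin

text \<open>
  Choose an admissible \<open>F\<close> outside of which representatives of the generators are defined. If some
  \<open>h \<in> H\<close> mapped a subtree onto one strictly inside it, \<open>h\<close> would preserve no cofinite subforest;
  so every \<open>H\<close>-orbit of vertices is an antichain. In particular at most \<open>card R\<close> ancestors of a
  vertex lie in an orbit of the finite set \<open>R\<close> of roots of the complement of \<open>F\<close>. Along a path of
  generators outside \<open>F\<close>, the depth grows only by bounded steps that leave such ancestors at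
  bounded distance from each other. Hence the depth stays bounded and the orbits of the partial
  action outside \<open>F\<close> are finite. Adding to \<open>F\<close> the orbits of the finitely many vertices that a
  generator moves into \<open>F\<close>, and then all prefixes, gives the required subforest.
\<close>

section \<open>Vertices, prefixes and admissible sets of the tree\<close>

abbreviation V :: "nat \<Rightarrow> nat list set" where
  "V d \<equiv> verts (tree_T d)"

lemma verts_tree_T: "v \<in> V d \<longleftrightarrow> v = [] \<or> (\<exists>w. v = 0 # w \<and> set w \<subseteq> {..<d})"
  by (auto simp: tree_T_def Let_def)

lemma prefix_in_verts: "prefix u v \<Longrightarrow> v \<in> V d \<Longrightarrow> u \<in> V d"
  by (cases u) (auto simp: verts_tree_T prefix_def)

lemma arcs_tree_T: "(u, v) \<in> arcs (tree_T d) \<longleftrightarrow> v \<in> V d \<and> v \<noteq> [] \<and> u = butlast v"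
proof
  assume R: "v \<in> V d \<and> v \<noteq> [] \<and> u = butlast v"
  then have v: "v = u @ [last v]" by simp
  with R have "u \<in> V d" by (metis prefix_in_verts prefixI)
  with R v have "\<exists>w i. (u, v) = (w, w @ [i]) \<and> w \<in> V d \<and> w @ [i] \<in> V d" by metis
  then show "(u, v) \<in> arcs (tree_T d)" by (auto simp: tree_T_def Let_def)
qed (auto simp: tree_T_def Let_def)

lemma finite_verts_length_le: "finite {v \<in> V d. length v \<le> n}"
proof (rule finite_subset)
  show "{v \<in> V d. length v \<le> n} \<subseteq> {v. set v \<subseteq> {..d} \<and> length v \<le> n}"
    by (auto simp: verts_tree_T)
  show "finite {v. set v \<subseteq> {..d} \<and> length v \<le> n}"
    by (rule finite_lists_length_le) simp
qed

lemma append_zeros_in_verts: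
  assumes "d \<ge> 1" "v \<in> V d" "v \<noteq> []"
  shows "v @ replicate n 0 \<in> V d"
  using assms by (auto simp: verts_tree_T)

lemma finite_length_bound: "finite (A :: 'a list set) \<Longrightarrow> \<exists>n. \<forall>v \<in> A. length v \<le> n"
  by (meson finite_imageI finite_nat_set_iff_bounded_le imageI)

text \<open>The parent of a vertex is its \<open>butlast\<close>, so closure under parents,
  iterated, is closure under prefixes.\<close>

lemma admissible_tree_T:
  "admissible (tree_T d) F \<longleftrightarrow> F \<subseteq> V d \<and> finite F \<and> (\<forall>u v. prefix u v \<longrightarrow> v \<in> F \<longrightarrow> u \<in> F)"
proof -
  have "(\<forall>u v. (u, v) \<in> arcs (tree_T d) \<longrightarrow> v \<in> F \<longrightarrow> u \<in> F) \<longleftrightarrow>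
      (\<forall>u v. prefix u v \<longrightarrow> v \<in> F \<longrightarrow> u \<in> F)" if F: "F \<subseteq> V d"
  proof
    assume A: "\<forall>u v. (u, v) \<in> arcs (tree_T d) \<longrightarrow> v \<in> F \<longrightarrow> u \<in> F"
    have "u \<in> F" if "prefix u v" "v \<in> F" for u v
      using that
    proof (induction v rule: rev_induct)
      case (snoc x v)
      have "(v, v @ [x]) \<in> arcs (tree_T d)"
        using snoc.prems F by (auto simp: arcs_tree_T)
      with A snoc show ?case by (metis prefix_snoc)
    qed simp
    then show "\<forall>u v. prefix u v \<longrightarrow> v \<in> F \<longrightarrow> u \<in> F" by blast
  qed (use prefixeq_butlast in \<open>auto simp: arcs_tree_T\<close>)
  then show ?thesis by (auto simp: admissible_iff[OF rooted_forest_tree_T])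
qed

lemma roots_cofinite_tree_T:
  "v \<in> roots (cofinite_subforest (tree_T d) F) \<longleftrightarrow>
     v \<in> V d - F \<and> (v = [] \<or> butlast v \<in> F)"
  by (auto simp: roots_cofinite_subforest[OF rooted_forest_tree_T] roots_tree_T arcs_tree_T
      verts_tree_T)

text \<open>A root other than \<open>[]\<close> is one letter longer than its parent in
  \<open>F\<close>, hence the bound \<open>Suc n\<close>.\<close>

lemma finite_roots_cofinite:
  assumes "admissible (tree_T d) F"
  shows "finite (roots (cofinite_subforest (tree_T d) F))"
proof -
  from assms obtain n where n: "\<forall>v \<in> F. length v \<le> n"
    using finite_length_bound admissible_tree_T by metis
  have "roots (cofinite_subforest (tree_T d) F) \<subseteq> {v \<in> V d. length v \<le> Suc n}"
    using n by (fastforce simp: roots_cofinite_tree_T)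
  then show ?thesis using finite_verts_length_le by (rule finite_subset)
qed

section \<open>Depth in the complement and rigidity of representatives\<close>

text \<open>The number of edges between \<open>w\<close> and the root of its component in the complement of \<open>F\<close>.\<close>

definition depth :: "nat list set \<Rightarrow> nat list \<Rightarrow> nat" where
  "depth F w = length w - (LEAST l. take l w \<notin> F)"

abbreviation ancestor :: "nat \<Rightarrow> nat list \<Rightarrow> nat list" where
  "ancestor k w \<equiv> take (length w - k) w"

lemma depth_le_length: "depth F w \<le> length w"
  by (simp add: depth_def)

text \<open>Keeps the truncated subtraction in \<open>depth\<close> exact outside
  \<open>F\<close>.\<close>

lemma Least_take_le: "w \<notin> F \<Longrightarrow> (LEAST l. take l w \<notin> F) \<le> length w"
  by (rule Least_le) simp

text \<open>Such an ancestor still extends the shortest prefix of \<open>w\<close> outside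
  \<open>F\<close>, and \<open>F\<close> is closed under prefixes.\<close>

lemma ancestor_notin:
  assumes F: "admissible (tree_T d) F" and w: "w \<in> V d - F" and k: "k \<le> depth F w"
  shows "ancestor k w \<in> V d - F"
proof -
  let ?l = "LEAST l. take l w \<notin> F"
  have l: "take ?l w \<notin> F" by (rule LeastI[of _ "length w"]) (use w in simp)
  have "?l \<le> length w - k" using k Least_take_le[of w F] w by (simp add: depth_def)
  then have "prefix (take ?l w) (ancestor k w)"
    by (metis min.absorb1 take_is_prefix take_take)
  with l F have "ancestor k w \<notin> F" unfolding admissible_tree_T by blast
  then show ?thesis using w prefix_in_verts take_is_prefix by blast
qed

text \<open>At distance \<open>depth F w\<close> stands the shortest prefix outside
  \<open>F\<close>; by minimality its parent, if any, lies in \<open>F\<close>.\<close>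

lemma ancestor_depth_root:
  assumes F: "admissible (tree_T d) F" and w: "w \<in> V d - F"
  shows "ancestor (depth F w) w \<in> roots (cofinite_subforest (tree_T d) F)"
proof -
  let ?l = "LEAST l. take l w \<notin> F"
  have eq: "length w - depth F w = ?l"
    using Least_take_le[of w F] w by (simp add: depth_def)
  have "butlast (take ?l w) \<in> F" if "take ?l w \<noteq> []"
  proof -
    from that have "?l > 0" by auto
    then have "take (?l - 1) w \<in> F" using not_less_Least[of "?l - 1" "\<lambda>l. take l w \<notin> F"] by auto
    moreover have "butlast (take ?l w) = take (?l - 1) w"
      using Least_take_le[of w F] w by (simp add: butlast_take)
    ultimately show ?thesis by simp
  qed
  then show ?thesis
    using ancestor_notin[OF F w order_refl] by (auto simp: roots_cofinite_tree_T eq)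
qed

text \<open>Since \<open>E\<close> is closed under prefixes, the path from \<open>u\<close> down to
  \<open>y\<close> avoids \<open>E\<close>. Arcs go to arcs, so each step of the path appends
  exactly one letter to the image.\<close>

lemma triple_prefix:
  assumes t: "(\<psi>, E, E') \<in> aaut_triples (tree_T d)"
    and u: "u \<in> V d - E" and y: "y \<in> V d" "prefix u y"
  shows "prefix (\<psi> u) (\<psi> y) \<and> length (\<psi> y) + length u = length y + length (\<psi> u)"
  using y
proof (induction y rule: rev_induct)
  case (snoc x y)
  note t' = t[unfolded aaut_triples_iff[OF rooted_forest_tree_T]]
  show ?case
  proof (cases "u = y @ [x]")
    case False
    with snoc.prems have uy: "prefix u y" by simp
    have yV: "y \<in> V d" using snoc.prems(1) prefix_in_verts by (metis prefixI)
    have E: "y \<notin> E" "y @ [x] \<notin> E"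
      using u uy snoc.prems t' unfolding admissible_tree_T by blast+
    have "(y, y @ [x]) \<in> arcs (tree_T d)" using snoc.prems by (simp add: arcs_tree_T)
    then have "(\<psi> y, \<psi> (y @ [x])) \<in> arcs (tree_T d)"
      using t' E yV snoc.prems(1) by blast
    then have "\<psi> (y @ [x]) \<noteq> []" "\<psi> y = butlast (\<psi> (y @ [x]))"
      by (auto simp: arcs_tree_T)
    then obtain z where "\<psi> (y @ [x]) = \<psi> y @ [z]" by (metis append_butlast_last_id)
    with snoc.IH[OF yV uy] show ?thesis by simp
  qed simp
qed (use u in simp)

text \<open>The converse is \<open>triple_prefix\<close> for the inverse representative.\<close>

lemma triple_prefix_iff:
  assumes t: "(\<psi>, E, E') \<in> aaut_triples (tree_T d)"
    and u: "u \<in> V d - E" and y: "y \<in> V d - E"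
  shows "prefix u y \<longleftrightarrow> prefix (\<psi> u) (\<psi> y)"
proof
  assume "prefix u y"
  then show "prefix (\<psi> u) (\<psi> y)" using triple_prefix[OF t u] y by blast
next
  let ?i = "inv_into (V d - E) \<psi>"
  have b: "bij_betw \<psi> (V d - E) (V d - E')"
    using t by (simp add: aaut_triples_iff[OF rooted_forest_tree_T])
  assume "prefix (\<psi> u) (\<psi> y)"
  moreover have "\<psi> u \<in> V d - E'" "\<psi> y \<in> V d" using b u y by (auto dest: bij_betwE)
  ultimately have "prefix (?i (\<psi> u)) (?i (\<psi> y))"
    using triple_prefix[OF aaut_triples_inv[OF t]] by blast
  then show "prefix u y" using b u y by (simp add: bij_betw_inv_into_left)
qed

lemma triple_ancestor:
  assumes t: "(\<psi>, E, E') \<in> aaut_triples (tree_T d)"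
    and y: "y \<in> V d" and k: "k \<le> length y" and u: "ancestor k y \<notin> E"
  shows "\<psi> (ancestor k y) = ancestor k (\<psi> y)"
    and "length (\<psi> y) = length (\<psi> (ancestor k y)) + k"
proof -
  have "ancestor k y \<in> V d - E" using u y prefix_in_verts take_is_prefix by blast
  from triple_prefix[OF t this y take_is_prefix]
  have p: "prefix (\<psi> (ancestor k y)) (\<psi> y)"
    and l: "length (\<psi> y) + (length y - k) = length y + length (\<psi> (ancestor k y))"
    by auto
  from l k show "length (\<psi> y) = length (\<psi> (ancestor k y)) + k" by simp
  then show "\<psi> (ancestor k y) = ancestor k (\<psi> y)" using p by (auto simp: prefix_def)
qed

section \<open>Calculus of shifts between subtrees\<close>

text \<open>
  The element \<open>g\<close> maps the subtree below \<open>a\<close> to the subtree below \<open>b\<close>, up to finitely many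
  vertices, and shifts levels there by \<open>length b - length a\<close>.
\<close>

definition shifts where
  "shifts d g a b \<longleftrightarrow> (\<exists>\<psi> E E' M. (\<psi>, E, E') \<in> g \<and> finite M \<and>
     (\<forall>y \<in> V d - M. (prefix a y \<longleftrightarrow> prefix b (\<psi> y)) \<and>
        (prefix a y \<longrightarrow> length (\<psi> y) + length a = length y + length b)))"

lemma shiftsI:
  assumes "(\<psi>, E, E') \<in> g" "finite M"
    and "\<And>y. y \<in> V d - M \<Longrightarrow> (prefix a y \<longleftrightarrow> prefix b (\<psi> y)) \<and>
        (prefix a y \<longrightarrow> length (\<psi> y) + length a = length y + length b)"
  shows "shifts d g a b"
  unfolding shifts_def using assms by blast

text \<open>Representatives of one class agree off a finite set, which is absorbed into the
  exceptional set.\<close>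

lemma shifts_representative:
  assumes g: "g \<in> carrier (neretin d)" "shifts d g a b" and t: "(\<psi>, E, E') \<in> g"
  obtains M where "finite M"
    "\<And>y. y \<in> V d - M \<Longrightarrow> prefix a y \<longleftrightarrow> prefix b (\<psi> y)"
    "\<And>y. y \<in> V d - M \<Longrightarrow> prefix a y \<Longrightarrow> length (\<psi> y) + length a = length y + length b"
proof -
  note T = rooted_forest_tree_T[of d]
  obtain \<phi> D D' M where p: "(\<phi>, D, D') \<in> g" "finite M"
    "\<forall>y \<in> V d - M. (prefix a y \<longleftrightarrow> prefix b (\<phi> y)) \<and>
        (prefix a y \<longrightarrow> length (\<phi> y) + length a = length y + length b)"
    using g(2) unfolding shifts_def by blast
  have "g \<in> aaut_triples (tree_T d) // aaut_rel (tree_T d)"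
    using g(1) by (simp add: neretin_def AAut_def)
  then have "((\<phi>, D, D'), (\<psi>, E, E')) \<in> aaut_rel (tree_T d)"
    using quotient_eq_iff[OF equiv_aaut_rel[OF T]] p(1) t by metis
  then obtain K where K: "finite K" "\<forall>x \<in> V d - K. \<phi> x = \<psi> x"
    unfolding aaut_rel_iff[OF T] admissible_def by blast
  have y: "\<phi> y = \<psi> y" "y \<in> V d - M" if "y \<in> V d - (M \<union> K)" for y
    using K(2) that by auto
  show ?thesis
  proof (rule that)
    show "finite (M \<union> K)" using p(2) K(1) by simp
    fix z assume z: "z \<in> V d - (M \<union> K)"
    show "prefix a z \<longleftrightarrow> prefix b (\<psi> z)"
      "prefix a z \<Longrightarrow> length (\<psi> z) + length a = length z + length b"
      using y[OF z] p(3)[rule_format, of z] by auto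
  qed
qed

lemma class_mem: "(\<psi>, E, E') \<in> aaut_triples (tree_T d) \<Longrightarrow> (\<psi>, E, E') \<in> aaut_class (tree_T d) \<psi> E E'"
  by (rule equiv_class_self[OF equiv_aaut_rel[OF rooted_forest_tree_T]])

lemma shifts_mult:
  assumes c: "g \<in> carrier (neretin d)" "h \<in> carrier (neretin d)"
    and s: "shifts d g a b" "shifts d h b c"
  shows "shifts d (h \<otimes>\<^bsub>neretin d\<^esub> g) a c"
proof -
  note T = rooted_forest_tree_T[of d]
  have "admissible (tree_T d) {}" by (simp add: admissible_tree_T)
  then obtain \<psi> \<phi> E G G' where r: "(\<psi>, G, G') \<in> aaut_triples (tree_T d)"
    "(\<phi>, E, G) \<in> aaut_triples (tree_T d)"
    "h = aaut_class (tree_T d) \<psi> G G'" "g = aaut_class (tree_T d) \<phi> E G"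
    using aaut_match[OF T, of h g "{}"] c unfolding neretin_def by metis
  obtain M where M: "finite M" "\<And>y. y \<in> V d - M \<Longrightarrow> prefix a y \<longleftrightarrow> prefix b (\<phi> y)"
    "\<And>y. y \<in> V d - M \<Longrightarrow> prefix a y \<Longrightarrow> length (\<phi> y) + length a = length y + length b"
    using shifts_representative[OF c(1) s(1)] class_mem[OF r(2)] r(4) by metis
  obtain N where N: "finite N" "\<And>y. y \<in> V d - N \<Longrightarrow> prefix b y \<longleftrightarrow> prefix c (\<psi> y)"
    "\<And>y. y \<in> V d - N \<Longrightarrow> prefix b y \<Longrightarrow> length (\<psi> y) + length b = length y + length c"
    using shifts_representative[OF c(2) s(2)] class_mem[OF r(1)] r(3) by metis
  have E: "finite E" "bij_betw \<phi> (V d - E) (V d - G)"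
    using r(2) by (auto simp: aaut_triples_iff[OF T] admissible_def)
  \<comment> \<open>Vertices sent by \<open>\<phi>\<close> into \<open>N\<close> are exceptional
    too; they are finitely many because \<open>\<phi>\<close> is injective off
    \<open>E\<close>.\<close>
  let ?K = "M \<union> E \<union> (\<phi> -` N \<inter> (V d - E))"
  have "finite (\<phi> -` N \<inter> (V d - E))"
    by (rule finite_vimage_IntI[OF N(1) bij_betw_imp_inj_on[OF E(2)]])
  then have fin: "finite ?K" using M(1) E(1) by simp
  have "(\<psi> \<circ> \<phi>, E, G') \<in> h \<otimes>\<^bsub>neretin d\<^esub> g"
    unfolding neretin_def r aaut_class_mult[OF T r(1,2)]
    by (rule class_mem[OF aaut_triples_comp[OF T r(1,2)]])
  then show ?thesis using fin
  proof (rule shiftsI)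
    fix y assume "y \<in> V d - ?K"
    then have y: "y \<in> V d - M" and "\<phi> y \<notin> N" "y \<in> V d - E" by auto
    with E(2) have z: "\<phi> y \<in> V d - N" by (auto dest: bij_betwE)
    show "(prefix a y \<longleftrightarrow> prefix c ((\<psi> \<circ> \<phi>) y)) \<and>
        (prefix a y \<longrightarrow> length ((\<psi> \<circ> \<phi>) y) + length a = length y + length c)"
      using M(2,3)[OF y] N(2,3)[OF z] by auto
  qed
qed

lemma one_eq_class:
  assumes F: "admissible (tree_T d) F"
  shows "(id, F, F) \<in> aaut_triples (tree_T d)"
    and "\<one>\<^bsub>neretin d\<^esub> = aaut_class (tree_T d) id F F"
proof -
  note T = rooted_forest_tree_T[of d]
  have id: "(id, F, F) \<in> aaut_triples (tree_T d)" if "admissible (tree_T d) F" for F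
    using that by (auto simp: aaut_triples_iff[OF T])
  show "(id, F, F) \<in> aaut_triples (tree_T d)" using id[OF F] .
  have "admissible (tree_T d) {}" by (simp add: admissible_tree_T)
  then show "\<one>\<^bsub>neretin d\<^esub> = aaut_class (tree_T d) id F F"
    using aaut_class_enlarge[OF T id id[OF F]] by (simp add: neretin_def AAut_def)
qed

text \<open>It suffices to check a left inverse: after \<open>\<psi>\<close>, the partial inverse
  agrees with \<open>id\<close> off \<open>E\<close>.\<close>

lemma inv_class:
  assumes t: "(\<psi>, E, E') \<in> aaut_triples (tree_T d)"
  shows "inv\<^bsub>neretin d\<^esub> (aaut_class (tree_T d) \<psi> E E') =
    aaut_class (tree_T d) (inv_into (V d - E) \<psi>) E' E"
proof -
  note T = rooted_forest_tree_T[of d]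
  let ?i = "inv_into (V d - E) \<psi>"
  note i = aaut_triples_inv[OF t]
  have E: "admissible (tree_T d) E" using t by (simp add: aaut_triples_def)
  have "inj_on \<psi> (V d - E)" using t by (auto simp: aaut_triples_iff[OF T] bij_betw_def)
  then have "((?i \<circ> \<psi>, E, E), (id, E, E)) \<in> aaut_rel (tree_T d)"
    using aaut_triples_comp[OF T i t] one_eq_class(1)[OF E] E
    by (auto simp: aaut_rel_iff[OF T] intro!: exI[of _ E])
  then have "aaut_class (tree_T d) (?i \<circ> \<psi>) E E = \<one>\<^bsub>neretin d\<^esub>"
    using equiv_class_eq[OF equiv_aaut_rel[OF T]] one_eq_class(2)[OF E] by metis
  then have "aaut_class (tree_T d) ?i E' E \<otimes>\<^bsub>neretin d\<^esub> aaut_class (tree_T d) \<psi> E E' = \<one>\<^bsub>neretin d\<^esub>"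
    using aaut_class_mult[OF T i t] by (simp add: neretin_def)
  then show ?thesis
    using aaut_carrierI[OF i] aaut_carrierI[OF t]
    by (intro group.inv_equality[OF group_neretin]) (auto simp: neretin_def)
qed

lemma shifts_inv:
  assumes c: "g \<in> carrier (neretin d)" and s: "shifts d g a b"
  shows "shifts d (inv\<^bsub>neretin d\<^esub> g) b a"
proof -
  note T = rooted_forest_tree_T[of d]
  obtain \<psi> E E' where t: "(\<psi>, E, E') \<in> aaut_triples (tree_T d)"
    and g: "g = aaut_class (tree_T d) \<psi> E E'"
    using c unfolding neretin_def by (rule aaut_carrierE)
  obtain M where M: "finite M" "\<And>y. y \<in> V d - M \<Longrightarrow> prefix a y \<longleftrightarrow> prefix b (\<psi> y)"
    "\<And>y. y \<in> V d - M \<Longrightarrow> prefix a y \<Longrightarrow> length (\<psi> y) + length a = length y + length b"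
    using shifts_representative[OF c s] class_mem[OF t] g by metis
  let ?i = "inv_into (V d - E) \<psi>"
  have E: "finite E'" "\<psi> ` (V d - E) = V d - E'"
    using t by (auto simp: aaut_triples_iff[OF T] admissible_def bij_betw_def)
  \<comment> \<open>Off \<open>E'\<close> every vertex has a preimage, and off the image of
    \<open>M\<close> that preimage is not exceptional.\<close>
  have sh: "(prefix b z \<longleftrightarrow> prefix a (?i z)) \<and>
      (prefix b z \<longrightarrow> length (?i z) + length b = length z + length a)"
    if z: "z \<in> V d - (E' \<union> \<psi> ` M)" for z
  proof -
    from z E(2) have z': "z \<in> \<psi> ` (V d - E)" by blast
    then have i: "?i z \<in> V d - E" "\<psi> (?i z) = z" by (rule inv_into_into, rule f_inv_into_f)
    with z have "?i z \<in> V d - M" by (metis DiffD1 DiffD2 DiffI UnCI imageI)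
    from M(2,3)[OF this] i(2) show ?thesis by auto
  qed
  have fin: "finite (E' \<union> \<psi> ` M)" using E M by simp
  have "(?i, E', E) \<in> inv\<^bsub>neretin d\<^esub> g"
    unfolding g inv_class[OF t] by (rule class_mem[OF aaut_triples_inv[OF t]])
  then show ?thesis using fin sh by (rule shiftsI)
qed

lemma shifts_triple:
  assumes t: "(\<psi>, E, E') \<in> aaut_triples (tree_T d)" and u: "u \<in> V d - E"
  shows "shifts d (aaut_class (tree_T d) \<psi> E E') u (\<psi> u)"
  using class_mem[OF t]
proof (rule shiftsI)
  show "finite E" using t by (simp add: aaut_triples_def admissible_def)
  show "(prefix u y \<longleftrightarrow> prefix (\<psi> u) (\<psi> y)) \<and>
      (prefix u y \<longrightarrow> length (\<psi> y) + length u = length y + length (\<psi> u))" if "y \<in> V d - E" for y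
    using triple_prefix_iff[OF t u that] triple_prefix[OF t u] that by blast
qed

lemma shifts_one: "u \<in> V d \<Longrightarrow> shifts d \<one>\<^bsub>neretin d\<^esub> u u"
proof -
  assume u: "u \<in> V d"
  have e: "admissible (tree_T d) {}" by (simp add: admissible_tree_T)
  show "shifts d \<one>\<^bsub>neretin d\<^esub> u u"
    using shifts_triple[OF one_eq_class(1)[OF e], of u] u one_eq_class(2)[OF e] by simp
qed

section \<open>Elements preserving a cofinite subforest\<close>

text \<open>
  Otherwise \<open>g\<close> would push deep vertices below \<open>a\<close> further and further down, whereas an automorphism
  of a cofinite subforest permutes its finitely many roots and preserves the depth below them.
\<close>

lemma aut_cofinite_not_shifts_down:
  assumes d: "d \<ge> 1" and g: "g \<in> aut_cofinite (tree_T d) F" and F: "admissible (tree_T d) F"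
    and ab: "strict_prefix a b" and b: "b \<in> V d"
  shows "\<not> shifts d g a b"
proof
  note T = rooted_forest_tree_T[of d]
  assume s: "shifts d g a b"
  from g obtain \<psi> where gc: "g \<in> carrier (neretin d)" and \<psi>: "(\<psi>, F, F) \<in> g"
    by (auto simp: aut_cofinite_def neretin_def)
  have t: "(\<psi>, F, F) \<in> aaut_triples (tree_T d)"
    using gc \<psi> in_quotient_imp_subset[OF equiv_aaut_rel[OF T]]
    by (auto simp: neretin_def AAut_def)
  let ?R = "roots (cofinite_subforest (tree_T d) F)"
  have R: "\<psi> ` ?R \<subseteq> ?R" using t by (simp add: aaut_triples_def rooted_forest_iso_def bij_betw_def)
  have im: "\<psi> y \<in> V d - F" if "y \<in> V d - F" for y
    using t that by (auto simp: aaut_triples_iff[OF T] dest: bij_betwE)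
  obtain M where M: "finite M" "\<And>y. y \<in> V d - M \<Longrightarrow> prefix a y \<longleftrightarrow> prefix b (\<psi> y)"
    "\<And>y. y \<in> V d - M \<Longrightarrow> prefix a y \<Longrightarrow> length (\<psi> y) + length a = length y + length b"
    using shifts_representative[OF gc s \<psi>] by metis
  obtain n where n: "\<forall>v \<in> F \<union> M. length v \<le> n"
    using finite_length_bound[of "F \<union> M"] M(1) F by (auto simp: admissible_def)
  obtain m where m: "\<forall>v \<in> ?R. length v \<le> m"
    using finite_length_bound finite_roots_cofinite[OF F] by blast
  \<comment> \<open>This vertex lies below \<open>b\<close>, hence below \<open>a\<close>, and is
    longer than every vertex of \<open>F\<close> and \<open>M\<close>, so it avoids both.\<close>
  define y where "y = b @ replicate (Suc n) 0"
  have "b \<noteq> []" using ab by auto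
  then have yV: "y \<in> V d" unfolding y_def using append_zeros_in_verts[OF d b] by blast
  \<comment> \<open>Each application adds \<open>length b - length a\<close>, at least 1, to the
    length, so the iterates never enter \<open>M\<close>.\<close>
  have iter: "(\<psi> ^^ j) y \<in> V d - F \<and> prefix a ((\<psi> ^^ j) y) \<and> length ((\<psi> ^^ j) y) \<ge> length y + j" for j
  proof (induction j)
    case 0
    have "length y > n" by (simp add: y_def)
    then have "y \<notin> F" using n by (meson UnI1 not_le)
    then show ?case using yV ab by (auto simp: y_def strict_prefix_def)
  next
    case (Suc j)
    let ?y = "(\<psi> ^^ j) y"
    have "length ?y > n" using Suc by (simp add: y_def)
    then have "?y \<in> V d - M" using n Suc by (meson DiffD1 DiffI UnI2 not_le)
    with M(2,3) Suc have p: "prefix b (\<psi> ?y)" "length (\<psi> ?y) + length a = length ?y + length b"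
      by blast+
    moreover have "length a < length b" using ab by (simp add: prefix_length_less)
    moreover have "prefix a (\<psi> ?y)" using p(1) ab prefix_order.less_imp_le prefix_order.trans by blast
    ultimately show ?case using Suc im by auto
  qed
  have y: "y \<in> V d - F" using iter[of 0] by simp
  let ?k = "depth F y"
  define r where "r = ancestor ?k y"
  have r: "r \<in> ?R" unfolding r_def using ancestor_depth_root[OF F y] .
  \<comment> \<open>The iterates of \<open>y\<close> stay at constant distance below those of the
    root \<open>r\<close>. At \<open>j = Suc m\<close> their growth forces a root longer than the
    bound \<open>m\<close>.\<close>
  have "(\<psi> ^^ j) r \<in> ?R \<and> prefix ((\<psi> ^^ j) r) ((\<psi> ^^ j) y) \<and>
      length ((\<psi> ^^ j) y) + length r = length y + length ((\<psi> ^^ j) r)" for j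
  proof (induction j)
    case 0
    show ?case using r by (simp add: r_def take_is_prefix)
  next
    case (Suc j)
    have "(\<psi> ^^ j) r \<in> V d - F" using Suc by (auto simp: roots_cofinite_tree_T)
    from triple_prefix[OF t this, of "(\<psi> ^^ j) y"] Suc iter[of j] R
    show ?case by auto
  qed
  from this[of "Suc m"] m iter[of "Suc m"] show False by fastforce
qed

section \<open>Orbits of vertices under a subgroup of elliptic elements\<close>

locale elliptic_subgroup =
  fixes d :: nat and H :: "((nat list \<Rightarrow> nat list) \<times> nat list set \<times> nat list set) set set"
  assumes d: "d \<ge> 1" and subgroup: "subgroup H (neretin d)"
    and elliptic: "\<And>g. g \<in> H \<Longrightarrow> \<exists>F. admissible (tree_T d) F \<and> g \<in> aut_cofinite (tree_T d) F"
begin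

text \<open>Elements of \<open>H\<close> act on vertices only up to finite sets;
  \<open>shifts\<close> gives an orbit relation on subtrees that does not depend on
  representatives.\<close>

definition same_orbit where
  "same_orbit a b \<longleftrightarrow> (\<exists>h \<in> H. shifts d h a b)"

lemma carrier: "h \<in> H \<Longrightarrow> h \<in> carrier (neretin d)"
  using subgroup subgroup.subset by blast

lemma same_orbit_refl: "a \<in> V d \<Longrightarrow> same_orbit a a"
  unfolding same_orbit_def using shifts_one subgroup.one_closed[OF subgroup] by blast

lemma same_orbit_trans:
  assumes "same_orbit a b" "same_orbit b c"
  shows "same_orbit a c"
  using assms shifts_mult carrier subgroup.m_closed[OF subgroup]
  unfolding same_orbit_def by metis

lemma same_orbit_sym:
  assumes "same_orbit a b"
  shows "same_orbit b a"
  using assms shifts_inv carrier subgroup.m_inv_closed[OF subgroup]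
  unfolding same_orbit_def by metis

text \<open>Ellipticity enters here: the element relating \<open>a\<close> to \<open>b\<close>
  preserves some cofinite subforest, so \<open>aut_cofinite_not_shifts_down\<close> applies.\<close>

lemma same_orbit_antichain:
  assumes "same_orbit a b" "b \<in> V d"
  shows "\<not> strict_prefix a b"
proof -
  from assms obtain h where h: "h \<in> H" "shifts d h a b" by (auto simp: same_orbit_def)
  then obtain F where "admissible (tree_T d) F" "h \<in> aut_cofinite (tree_T d) F"
    using elliptic by blast
  with h assms(2) aut_cofinite_not_shifts_down[OF d] show ?thesis by blast
qed

text \<open>Ancestors are recorded by their distance above \<open>w\<close>, because a
  representative defined at an ancestor preserves this distance.\<close>

definition root_depths where
  "root_depths F w = {k. k \<le> depth F w \<and>
     (\<exists>r \<in> roots (cofinite_subforest (tree_T d) F). same_orbit r (ancestor k w))}"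

text \<open>Two ancestors assigned to the same root would lie in one orbit, yet one is a strict
  prefix of the other. So the assignment is injective.\<close>

lemma card_root_depths:
  assumes F: "admissible (tree_T d) F" and w: "w \<in> V d"
  shows "card (root_depths F w) \<le> card (roots (cofinite_subforest (tree_T d) F))"
proof -
  let ?R = "roots (cofinite_subforest (tree_T d) F)"
  have "\<forall>k \<in> root_depths F w. \<exists>r. r \<in> ?R \<and> same_orbit r (ancestor k w)"
    by (auto simp: root_depths_def)
  then obtain f where f: "\<forall>k \<in> root_depths F w. f k \<in> ?R \<and> same_orbit (f k) (ancestor k w)"
    by (rule bchoice[THEN exE])
  have ne: "f k \<noteq> f j" if kj: "k \<in> root_depths F w" "j \<in> root_depths F w" "k < j" for k j
  proof
    assume "f k = f j"
    with f kj have "same_orbit (ancestor j w) (ancestor k w)"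
      using same_orbit_sym same_orbit_trans by metis
    moreover have "ancestor k w \<in> V d" using w prefix_in_verts take_is_prefix by blast
    ultimately have "\<not> strict_prefix (ancestor j w) (ancestor k w)"
      by (rule same_orbit_antichain)
    moreover have "j \<le> length w"
      using kj(2) depth_le_length[of F w] by (auto simp: root_depths_def)
    then have "length w - j < length w - k" using kj(3) by linarith
    then have "ancestor j w = take (length w - j) (ancestor k w)"
      and "length (ancestor j w) < length (ancestor k w)"
      by simp_all
    then have "strict_prefix (ancestor j w) (ancestor k w)"
      by (metis less_irrefl strict_prefixI take_is_prefix)
    ultimately show False by blast
  qed
  then have "inj_on f (root_depths F w)" by (metis inj_onI linorder_neqE_nat)
  then show ?thesis
    using f finite_roots_cofinite[OF F] by (intro card_inj_on_le[of f]) auto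
qed

lemma depth_in_root_depths:
  assumes F: "admissible (tree_T d) F" and w: "w \<in> V d - F"
  shows "depth F w \<in> root_depths F w"
  using ancestor_depth_root[OF F w] same_orbit_refl
  by (force simp: root_depths_def roots_cofinite_tree_T)

text \<open>
  A step may only lower the depth, in which case the larger elements of \<open>root_depths\<close> are lost,
  or raise it by at most \<open>K\<close>, in which case the new depth is again an element. So the gaps of
  \<open>root_depths\<close> above the initial depth never exceed \<open>K\<close>.
\<close>

lemma root_depths_gap_step:
  assumes F: "admissible (tree_T d) F"
    and t: "(\<psi>, E, E') \<in> aaut_triples (tree_T d)" and E: "E \<subseteq> F"
    and H: "aaut_class (tree_T d) \<psi> E E' \<in> H"
    and K: "\<forall>r \<in> roots (cofinite_subforest (tree_T d) F). length (\<psi> r) \<le> K"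
    and w: "w \<in> V d - F" and w': "\<psi> w \<in> V d - F"
    and gap: "\<forall>k. m \<le> k \<and> k \<le> depth F w \<longrightarrow> (\<exists>j \<in> root_depths F w. k \<le> j \<and> j \<le> k + K)"
  shows "\<forall>k. m \<le> k \<and> k \<le> depth F (\<psi> w) \<longrightarrow> (\<exists>j \<in> root_depths F (\<psi> w). k \<le> j \<and> j \<le> k + K)"
proof (intro allI impI)
  fix k assume k: "m \<le> k \<and> k \<le> depth F (\<psi> w)"
  have anc: "\<psi> (ancestor j w) = ancestor j (\<psi> w)" "length (\<psi> w) = length (\<psi> (ancestor j w)) + j"
    if "j \<le> depth F w" for j
  proof -
    have "w \<in> V d" "j \<le> length w" using w that depth_le_length[of F w] by auto
    moreover have "ancestor j w \<notin> E" using ancestor_notin[OF F w that] E by blast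
    ultimately show "\<psi> (ancestor j w) = ancestor j (\<psi> w)"
      "length (\<psi> w) = length (\<psi> (ancestor j w)) + j"
      by (rule triple_ancestor[OF t])+
  qed
  have "depth F (\<psi> w) \<le> length (\<psi> w)" by (rule depth_le_length)
  \<comment> \<open>The root above \<open>w\<close> has an image of length at most \<open>K\<close>,
    and the distance \<open>depth F w\<close> below it is preserved.\<close>
  also have "\<dots> \<le> depth F w + K"
    using anc(2)[OF order_refl] K ancestor_depth_root[OF F w] by fastforce
  finally have up: "depth F (\<psi> w) \<le> depth F w + K" .
  show "\<exists>j \<in> root_depths F (\<psi> w). k \<le> j \<and> j \<le> k + K"
  \<comment> \<open>In the first case the old \<open>j\<close> is at most \<open>k + K\<close>,
    hence within the new depth, and survives. Otherwise the new depth itself serves as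
    \<open>j\<close>.\<close>
  proof (cases "k \<le> depth F w \<and> k + K \<le> depth F (\<psi> w)")
    case True
    with gap k obtain j where j: "j \<in> root_depths F w" "k \<le> j" "j \<le> k + K" by blast
    then obtain r where r: "r \<in> roots (cofinite_subforest (tree_T d) F)"
      "same_orbit r (ancestor j w)" "j \<le> depth F w" by (auto simp: root_depths_def)
    have "ancestor j w \<in> V d - E" using ancestor_notin[OF F w r(3)] E by blast
    from shifts_triple[OF t this] H have "same_orbit (ancestor j w) (\<psi> (ancestor j w))"
      unfolding same_orbit_def by blast
    with r(2) anc(1)[OF r(3)] have "same_orbit r (ancestor j (\<psi> w))"
      using same_orbit_trans by metis
    with r j True have "j \<in> root_depths F (\<psi> w)" by (auto simp: root_depths_def)
    with j show ?thesis by blast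
  next
    case False
    with up have "depth F (\<psi> w) \<le> k + K" by linarith
    with k depth_in_root_depths[OF F w'] show ?thesis by blast
  qed
qed

text \<open>Otherwise \<open>root_depths\<close> would meet each of \<open>?n + 1\<close> disjoint
  windows of \<open>K + 1\<close> consecutive numbers, starting at \<open>m\<close>, against
  \<open>card_root_depths\<close>.\<close>

lemma depth_bound_of_gaps:
  assumes F: "admissible (tree_T d) F" and w: "w \<in> V d"
    and gap: "\<forall>k. m \<le> k \<and> k \<le> depth F w \<longrightarrow> (\<exists>j \<in> root_depths F w. k \<le> j \<and> j \<le> k + K)"
  shows "depth F w < m + card (roots (cofinite_subforest (tree_T d) F)) * (K + 1)"
proof (rule ccontr)
  let ?n = "card (roots (cofinite_subforest (tree_T d) F))"
  assume "\<not> depth F w < m + ?n * (K + 1)"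
  then have n: "m + ?n * (K + 1) \<le> depth F w" by simp
  have "\<exists>j \<in> root_depths F w. m + i * (K + 1) \<le> j \<and> j \<le> m + i * (K + 1) + K" if "i \<le> ?n" for i
  proof -
    have "i * (K + 1) \<le> ?n * (K + 1)" using that by (rule mult_le_mono1)
    with n gap show ?thesis by (meson add_left_mono le_add1 order_trans)
  qed
  then have "\<forall>i \<in> {..?n}. \<exists>j. j \<in> root_depths F w \<and> m + i * (K + 1) \<le> j \<and> j \<le> m + i * (K + 1) + K"
    by auto
  then obtain f where f: "\<forall>i \<in> {..?n}. f i \<in> root_depths F w \<and>
      m + i * (K + 1) \<le> f i \<and> f i \<le> m + i * (K + 1) + K"
    by (rule bchoice[THEN exE])
  have "f i \<noteq> f j" if "i \<le> ?n" "j \<le> ?n" "i < j" for i j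
  proof -
    have "(i + 1) * (K + 1) \<le> j * (K + 1)" using that by (intro mult_le_mono1) simp
    then have "m + i * (K + 1) + K < m + j * (K + 1)" by simp
    moreover have "f i \<le> m + i * (K + 1) + K" "m + j * (K + 1) \<le> f j" using f that by auto
    ultimately show ?thesis by linarith
  qed
  then have "inj_on f {..?n}" by (metis atMost_iff inj_onI linorder_neqE_nat)
  moreover have "f ` {..?n} \<subseteq> root_depths F w" using f by auto
  moreover have "finite (root_depths F w)" by (simp add: root_depths_def)
  ultimately have "card {..?n} \<le> card (root_depths F w)" by (rule card_inj_on_le)
  with card_root_depths[OF F w] show False by simp
qed

section \<open>Finite orbits and a common invariant subforest\<close>

definition moves where
  "moves P F = {(u, w). u \<in> V d - F \<and> w \<in> V d - F \<and> (\<exists>(\<psi>, E, E') \<in> P. w = \<psi> u)}"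

text \<open>Bounded gaps propagate along moves and bound the depth; with the bounded length of the
  roots this bounds the length of every vertex reached.\<close>

lemma finite_orbit:
  assumes F: "admissible (tree_T d) F" and P: "finite P"
    and PF: "\<And>\<psi> E E'. (\<psi>, E, E') \<in> P \<Longrightarrow> (\<psi>, E, E') \<in> aaut_triples (tree_T d) \<and> E \<subseteq> F \<and>
      aaut_class (tree_T d) \<psi> E E' \<in> H"
    and v: "v \<in> V d - F"
  shows "finite ((moves P F)\<^sup>* `` {v})"
proof -
  let ?R = "roots (cofinite_subforest (tree_T d) F)"
  let ?n = "card ?R"
  have "finite ((\<lambda>((\<psi>, _, _), r). \<psi> r) ` (P \<times> ?R))"
    using P finite_roots_cofinite[OF F] by blast
  \<comment> \<open>One \<open>K\<close> serves all of \<open>P\<close>, since \<open>P\<close> and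
    the set of roots are finite.\<close>
  then obtain K where "\<forall>x \<in> (\<lambda>((\<psi>, _, _), r). \<psi> r) ` (P \<times> ?R). length x \<le> K"
    using finite_length_bound by blast
  then have K: "\<forall>r \<in> ?R. length (\<psi> r) \<le> K" if "(\<psi>, E, E') \<in> P" for \<psi> E E'
    using that by force
  obtain L where L: "\<forall>r \<in> ?R. length r \<le> L"
    using finite_length_bound finite_roots_cofinite[OF F] by blast
  let ?m = "depth F v"
  have gap: "w \<in> V d - F \<and>
      (\<forall>k. ?m \<le> k \<and> k \<le> depth F w \<longrightarrow> (\<exists>j \<in> root_depths F w. k \<le> j \<and> j \<le> k + K))"
    if "(v, w) \<in> (moves P F)\<^sup>*" for w
    using that
  proof (induction rule: rtrancl_induct)
    case base
    \<comment> \<open>At the start \<open>k\<close> can only be the depth of \<open>v\<close>, and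
      \<open>j = k\<close> works.\<close>
    show ?case using v depth_in_root_depths[OF F v] by (metis le_add1 order_antisym order_refl)
  next
    case (step u w)
    then obtain \<psi> E E' where p: "(\<psi>, E, E') \<in> P" "w = \<psi> u" and w: "w \<in> V d - F"
      by (auto simp: moves_def)
    with root_depths_gap_step[OF F _ _ _ K[OF p(1)], of E E' u ?m] PF[OF p(1)] step.IH
    show ?case by blast
  qed
  have "length w \<le> ?m + ?n * (K + 1) + L" if "(v, w) \<in> (moves P F)\<^sup>*" for w
  proof -
    from gap[OF that] have w: "w \<in> V d - F"
      and "depth F w < ?m + ?n * (K + 1)" using depth_bound_of_gaps[OF F] by auto
    \<comment> \<open>The difference is the length of the root above \<open>w\<close>.\<close>
    moreover have "length w - depth F w \<le> L"
      using L ancestor_depth_root[OF F w] by fastforce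
    ultimately show ?thesis by linarith
  qed
  with gap have "(moves P F)\<^sup>* `` {v} \<subseteq> {w \<in> V d. length w \<le> ?m + ?n * (K + 1) + L}" by blast
  then show ?thesis using finite_verts_length_le by (rule finite_subset)
qed

text \<open>Closure under inverses, \<open>Pinv\<close>, lets orbits be traced backwards and turns
  stability of the complement into bijectivity.\<close>

lemma common_invariant_subforest:
  assumes P: "finite P"
    and PH: "\<And>\<psi> E E'. (\<psi>, E, E') \<in> P \<Longrightarrow> (\<psi>, E, E') \<in> aaut_triples (tree_T d) \<and>
      aaut_class (tree_T d) \<psi> E E' \<in> H"
    and Pinv: "\<And>\<psi> E E'. (\<psi>, E, E') \<in> P \<Longrightarrow> \<exists>\<phi>. (\<phi>, E', E) \<in> P \<and> (\<forall>x \<in> V d - E. \<phi> (\<psi> x) = x)"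
  obtains F where "admissible (tree_T d) F"
    "\<And>\<psi> E E'. (\<psi>, E, E') \<in> P \<Longrightarrow> (\<psi>, F, F) \<in> aaut_triples (tree_T d)"
proof -
  note T = rooted_forest_tree_T[of d]
  \<comment> \<open>By \<open>Pinv\<close> this union also contains every \<open>E'\<close>.\<close>
  define F where "F = (\<Union>(\<psi>, E, E') \<in> P. E)"
  have adE: "admissible (tree_T d) E" "admissible (tree_T d) E'"
    and bij: "bij_betw \<psi> (V d - E) (V d - E')" if "(\<psi>, E, E') \<in> P" for \<psi> E E'
    using PH[OF that] by (auto simp: aaut_triples_iff[OF T])
  have F: "admissible (tree_T d) F"
    unfolding admissible_tree_T
  proof (intro conjI)
    show "F \<subseteq> V d" using adE(1) unfolding F_def admissible_def by blast
    show "\<forall>u v. prefix u v \<longrightarrow> v \<in> F \<longrightarrow> u \<in> F"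
    proof (intro allI impI)
      fix u v assume uv: "prefix u v" "v \<in> F"
      then obtain \<psi> E E' where p: "(\<psi>, E, E') \<in> P" "v \<in> E" by (auto simp: F_def)
      with adE(1)[OF p(1)] uv(1) have "u \<in> E" unfolding admissible_tree_T by blast
      with p(1) show "u \<in> F" unfolding F_def by blast
    qed
    show "finite F" using P adE(1) by (auto simp: F_def admissible_tree_T)
  qed
  have EF: "E \<subseteq> F" "E' \<subseteq> F" if "(\<psi>, E, E') \<in> P" for \<psi> E E'
    using that Pinv[OF that] unfolding F_def by blast+
  let ?\<Gamma> = "moves P F"
  \<comment> \<open>The vertices at which some move would leave the complement of \<open>F\<close>;
    injectivity makes them finitely many.\<close>
  define B where "B = {b \<in> V d - F. \<exists>(\<psi>, E, E') \<in> P. \<psi> b \<in> F}"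
  have "B = (\<Union>(\<psi>, E, E') \<in> P. \<psi> -` F \<inter> (V d - F))" by (auto simp: B_def)
  moreover have "finite (\<psi> -` F \<inter> (V d - F))" if "(\<psi>, E, E') \<in> P" for \<psi> E E'
  proof (rule finite_vimage_IntI)
    show "finite F" using F by (simp add: admissible_def)
    show "inj_on \<psi> (V d - F)"
      using bij[OF that] EF(1)[OF that] by (auto simp: bij_betw_def intro: inj_on_subset)
  qed
  ultimately have finB: "finite B" using P by auto
  define F1 where "F1 = F \<union> (\<Union>b \<in> B. ?\<Gamma>\<^sup>* `` {b})"
  have "finite (?\<Gamma>\<^sup>* `` {b})" if "b \<in> B" for b
    by (rule finite_orbit[OF F P]) (use that PH EF in \<open>auto simp: B_def\<close>)
  then have finF1: "finite F1" using finB F by (auto simp: F1_def admissible_def)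
  have F1: "\<psi> v \<notin> F1" if p: "(\<psi>, E, E') \<in> P" and v: "v \<in> V d - F1" for \<psi> E E' v
  proof -
    have vF: "v \<in> V d - F" using v by (auto simp: F1_def)
    have "v \<notin> B" using v by (auto simp: F1_def)
    then have wF: "\<psi> v \<notin> F" using p vF by (auto simp: B_def)
    have "v \<in> V d - E" using vF EF[OF p] by blast
    then obtain \<phi> where \<phi>: "(\<phi>, E', E) \<in> P" "v = \<phi> (\<psi> v)" using Pinv[OF p] by metis
    have w: "\<psi> v \<in> V d - F" using bij[OF p] wF \<open>v \<in> V d - E\<close> by (auto dest: bij_betwE)
    \<comment> \<open>The inverse move leads from \<open>\<psi> v\<close> back to \<open>v\<close>,
      so an orbit in \<open>F1\<close> reaching \<open>\<psi> v\<close> would contain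
      \<open>v\<close> as well.\<close>
    have "(\<psi> v, v) \<in> ?\<Gamma>"
      unfolding moves_def using w vF \<phi> by blast
    then have "v \<in> ?\<Gamma>\<^sup>* `` {b}" if "\<psi> v \<in> ?\<Gamma>\<^sup>* `` {b}" for b
      using that by (auto intro: rtrancl_into_rtrancl)
    with v wF show ?thesis by (auto simp: F1_def)
  qed
  have F1V: "F1 \<subseteq> V d"
    using F by (auto simp: F1_def B_def moves_def admissible_def elim: rtranclE)
  \<comment> \<open>The orbits added to \<open>F\<close> may break closure under prefixes; adding
    all prefixes restores it.\<close>
  define F2 where "F2 = {u \<in> V d. \<exists>v \<in> F1. prefix u v}"
  have "F2 \<subseteq> (\<Union>v \<in> F1. set (prefixes v))" by (auto simp: F2_def)
  then have "finite F2" by (rule finite_subset) (use finF1 in simp)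
  then have F2: "admissible (tree_T d) F2"
    unfolding admissible_tree_T F2_def
    using prefix_in_verts prefix_order.trans by blast
  have FF2: "F \<subseteq> F2" using F by (auto simp: F1_def F2_def admissible_def)
  have stable: "\<psi> v \<in> V d - F2" if p: "(\<psi>, E, E') \<in> P" and v: "v \<in> V d - F2" for \<psi> E E' v
  proof
    have vE: "v \<in> V d - E" using v EF[OF p] FF2 by blast
    then show w: "\<psi> v \<in> V d" using bij[OF p] by (auto dest: bij_betwE)
    show "\<psi> v \<notin> F2"
    proof
      assume "\<psi> v \<in> F2"
      \<comment> \<open>The vertex \<open>z\<close> below \<open>\<psi> v\<close> pulls back to some
        \<open>y\<close> below \<open>v\<close>. As \<open>v\<close> is outside \<open>F2\<close>,
        \<open>y\<close> is outside \<open>F1\<close>, and then so is its image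
        \<open>z\<close>.\<close>
      then obtain z where z: "z \<in> F1" "prefix (\<psi> v) z" by (auto simp: F2_def)
      have "\<psi> v \<in> V d - E'" using vE bij[OF p] by (auto dest: bij_betwE)
      then have "z \<notin> E'" using z(2) adE(2)[OF p] unfolding admissible_tree_T by blast
      moreover have "z \<in> V d" using z(1) F1V by blast
      ultimately obtain y where y: "y \<in> V d - E" "z = \<psi> y"
        using bij[OF p] unfolding bij_betw_def by blast
      then have "prefix v y" using triple_prefix_iff vE PH[OF p] z(2) by metis
      then have "y \<notin> F1" using v unfolding F2_def by blast
      with F1[OF p] y z(1) show False by blast
    qed
  qed
  show ?thesis
  proof (rule that[OF F2])
    fix \<psi> E E' assume p: "(\<psi>, E, E') \<in> P"
    have sub: "V d - F2 \<subseteq> V d - E" using EF[OF p] FF2 by blast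
    have "\<psi> ` (V d - F2) = V d - F2"
    proof
      show "\<psi> ` (V d - F2) \<subseteq> V d - F2" using stable[OF p] by blast
      show "V d - F2 \<subseteq> \<psi> ` (V d - F2)"
      proof
        fix y assume y: "y \<in> V d - F2"
        then have "y \<in> V d - E'" using EF[OF p] FF2 by blast
        then obtain x where x: "x \<in> V d - E" "y = \<psi> x"
          using bij[OF p] by (auto simp: bij_betw_def)
        with Pinv[OF p] obtain \<phi> where \<phi>: "(\<phi>, E', E) \<in> P" "\<psi> (\<phi> y) = y" by metis
        from stable[OF \<phi>(1) y] \<phi>(2) show "y \<in> \<psi> ` (V d - F2)" by (metis imageI)
      qed
    qed
    moreover have "inj_on \<psi> (V d - F2)"
      using bij[OF p] sub by (auto simp: bij_betw_def intro: inj_on_subset)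
    ultimately show "(\<psi>, F2, F2) \<in> aaut_triples (tree_T d)"
      using PH[OF p] F2 sub unfolding aaut_triples_iff[OF T] bij_betw_def by blast
  qed
qed

end

section \<open>The automorphism group of a cofinite subforest\<close>

lemma aut_cofiniteI:
  assumes "(\<psi>, F, F) \<in> aaut_triples (tree_T d)"
  shows "aaut_class (tree_T d) \<psi> F F \<in> aut_cofinite (tree_T d) F"
  using class_mem[OF assms] aaut_carrierI[OF assms] by (auto simp: aut_cofinite_def)

lemma aut_cofiniteE:
  assumes "g \<in> aut_cofinite (tree_T d) F"
  obtains \<psi> where "(\<psi>, F, F) \<in> aaut_triples (tree_T d)" "g = aaut_class (tree_T d) \<psi> F F"
proof -
  note T = rooted_forest_tree_T[of d]
  obtain \<psi> where g: "g \<in> aaut_triples (tree_T d) // aaut_rel (tree_T d)" and p: "(\<psi>, F, F) \<in> g"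
    using assms by (auto simp: aut_cofinite_def AAut_def)
  obtain x where x: "g = aaut_rel (tree_T d) `` {x}" using g by (rule quotientE)
  with p have "(x, (\<psi>, F, F)) \<in> aaut_rel (tree_T d)" by simp
  then have "g = aaut_class (tree_T d) \<psi> F F"
    unfolding x by (rule equiv_class_eq[OF equiv_aaut_rel[OF T]])
  moreover have "(\<psi>, F, F) \<in> aaut_triples (tree_T d)"
    using g p in_quotient_imp_subset[OF equiv_aaut_rel[OF T]] by blast
  ultimately show ?thesis using that by blast
qed

text \<open>Representatives from the complement of \<open>F\<close> to itself compose and invert
  without enlarging \<open>F\<close>.\<close>

lemma subgroup_aut_cofinite:
  assumes F: "admissible (tree_T d) F"
  shows "subgroup (aut_cofinite (tree_T d) F) (neretin d)"
proof (rule group.subgroupI[OF group_neretin])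
  note T = rooted_forest_tree_T[of d]
  show "aut_cofinite (tree_T d) F \<subseteq> carrier (neretin d)"
    by (auto simp: aut_cofinite_def neretin_def)
  show "aut_cofinite (tree_T d) F \<noteq> {}"
    using aut_cofiniteI[OF one_eq_class(1)[OF F]] by blast
  show "inv\<^bsub>neretin d\<^esub> g \<in> aut_cofinite (tree_T d) F" if "g \<in> aut_cofinite (tree_T d) F" for g
    using that by (rule aut_cofiniteE) (simp add: inv_class aut_cofiniteI aaut_triples_inv)
  show "g \<otimes>\<^bsub>neretin d\<^esub> h \<in> aut_cofinite (tree_T d) F"
    if g: "g \<in> aut_cofinite (tree_T d) F" and h: "h \<in> aut_cofinite (tree_T d) F" for g h
  proof -
    obtain \<psi> \<phi> where t: "(\<psi>, F, F) \<in> aaut_triples (tree_T d)" "(\<phi>, F, F) \<in> aaut_triples (tree_T d)"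
      and "g = aaut_class (tree_T d) \<psi> F F" "h = aaut_class (tree_T d) \<phi> F F"
      using g h by (metis aut_cofiniteE)
    then show ?thesis
      using aaut_class_mult[OF T t] aut_cofiniteI[OF aaut_triples_comp[OF T t]]
      by (simp add: neretin_def)
  qed
qed

section \<open>From the generators to the generated subgroup\<close>

theorem theorem1p2:
  fixes d :: nat
    and H :: "((nat list \<Rightarrow> nat list) \<times> nat list set \<times> nat list set) set set"
  assumes "d \<ge> 2"
    and "finitely_generated_subgroup (neretin d) H"
    and "\<And>g. g \<in> H \<Longrightarrow> \<exists>F. admissible (tree_T d) F \<and> g \<in> aut_cofinite (tree_T d) F"
  shows "\<exists>F. admissible (tree_T d) F \<and> H \<subseteq> aut_cofinite (tree_T d) F"
proof -
  note T = rooted_forest_tree_T[of d]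
  obtain S where S: "finite S" "S \<subseteq> carrier (neretin d)" "H = generate (neretin d) S"
    and sub: "subgroup H (neretin d)"
    using assms(2) unfolding finitely_generated_subgroup_def by blast
  interpret elliptic: elliptic_subgroup d H
    by (rule elliptic_subgroup.intro) (use assms(1,3) sub in simp_all)
  have "\<forall>g \<in> S. \<exists>t. t \<in> aaut_triples (tree_T d) \<and> g = aaut_rel (tree_T d) `` {t}"
    using S(2) by (metis (no_types) aaut_carrierE neretin_def subsetD)
  then obtain t where t: "\<forall>g \<in> S. t g \<in> aaut_triples (tree_T d) \<and> g = aaut_rel (tree_T d) `` {t g}"
    by (rule bchoice[THEN exE])
  \<comment> \<open>Partial inverses are added to the chosen representatives to obtain the closure
    \<open>Pinv\<close>.\<close>
  define P where "P = t ` S \<union> (\<lambda>(\<psi>, E, E'). (inv_into (V d - E) \<psi>, E', E)) ` t ` S"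
  have tS: "(\<psi>, E, E') \<in> aaut_triples (tree_T d) \<and> aaut_class (tree_T d) \<psi> E E' \<in> H"
    if "(\<psi>, E, E') \<in> t ` S" for \<psi> E E'
    using that t S(3) generate.incl by fastforce
  have PH: "(\<psi>, E, E') \<in> aaut_triples (tree_T d) \<and> aaut_class (tree_T d) \<psi> E E' \<in> H"
    if "(\<psi>, E, E') \<in> P" for \<psi> E E'
  proof (cases "(\<psi>, E, E') \<in> t ` S")
    case False
    with that obtain \<phi> where "(\<phi>, E', E) \<in> t ` S" "\<psi> = inv_into (V d - E') \<phi>"
      by (auto simp: P_def)
    with tS[of \<phi> E' E] show ?thesis
      using aaut_triples_inv inv_class subgroup.m_inv_closed[OF sub] by metis
  qed (use tS in blast)
  have Pinv: "\<exists>\<phi>. (\<phi>, E', E) \<in> P \<and> (\<forall>x \<in> V d - E. \<phi> (\<psi> x) = x)"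
    if "(\<psi>, E, E') \<in> P" for \<psi> E E'
  proof (cases "(\<psi>, E, E') \<in> t ` S")
    case True
    then have "(inv_into (V d - E) \<psi>, E', E) \<in> P" unfolding P_def by force
    moreover have "inv_into (V d - E) \<psi> (\<psi> x) = x" if "x \<in> V d - E" for x
      using tS[OF True] that
      by (auto simp: aaut_triples_iff[OF T] bij_betw_def intro: inv_into_f_f)
    ultimately show ?thesis by blast
  next
    case False
    with that obtain \<phi> where \<phi>: "(\<phi>, E', E) \<in> t ` S" "\<psi> = inv_into (V d - E') \<phi>"
      by (auto simp: P_def)
    have "\<phi> (\<psi> x) = x" if "x \<in> V d - E" for x
      using tS[OF \<phi>(1)] that \<phi>(2)
      by (auto simp: aaut_triples_iff[OF T] bij_betw_inv_into_right)
    with \<phi>(1) show ?thesis unfolding P_def by blast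
  qed
  have "finite P" using S(1) by (simp add: P_def)
  then obtain F where F: "admissible (tree_T d) F"
    "\<And>\<psi> E E'. (\<psi>, E, E') \<in> P \<Longrightarrow> (\<psi>, F, F) \<in> aaut_triples (tree_T d)"
    using PH Pinv by (rule elliptic.common_invariant_subforest) blast+
  have "S \<subseteq> aut_cofinite (tree_T d) F"
  proof
    fix g assume g: "g \<in> S"
    obtain \<psi> E E' where p: "t g = (\<psi>, E, E')" by (metis prod_cases3)
    with g have "(\<psi>, E, E') \<in> P" by (force simp: P_def)
    \<comment> \<open>Enlarging both omitted sets to \<open>F\<close> does not change the
      class.\<close>
    from F(2)[OF this] PH[OF this] have "g = aaut_class (tree_T d) \<psi> F F"
      using t g p aaut_class_enlarge[OF T] by metis
    with aut_cofiniteI[OF F(2)[OF \<open>(\<psi>, E, E') \<in> P\<close>]] show "g \<in> aut_cofinite (tree_T d) F" by simp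
  qed
  then have "H \<subseteq> aut_cofinite (tree_T d) F"
    unfolding S(3)
    using group.generate_subgroup_incl[OF group_neretin _ subgroup_aut_cofinite[OF F(1)]] by blast
  with F(1) show ?thesis by blast
qed

end
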